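(* Let $n\ge 4$. The graph $\Gamma_e(\mathcal A_{n+1})$, given without labels of elements on its vertices, determines the graphs $\Gamma_e(\mathcal A_n^{\circ})$ and $\Gamma_e(\mathcal A_n^{\bullet})$. Precisely: let $\gamma=(\gamma_0,\dots,\gamma_n)$ and $\lambda=(\lambda_0,\dots,\lambda_n)$ be two sequences in $\{1,-1\}^{n+1}$. If $\Gamma_e(\mathcal A^{\gamma}_{n+1})\cong\Gamma_e(\mathcal A^{\lambda}_{n+1})$, then $\Gamma_e(\mathcal A_n^{\gamma,\circ})\cong\Gamma_e(\mathcal A_n^{\lambda,\circ})$ and $\Gamma_e(\mathcal A_n^{\gamma,\bullet})\cong\Gamma_e(\mathcal A_n^{\lambda,\bullet})$.
   Context: Cayley–Dickson algebras: $\mathcal A_0=\mathbb R$ with trivial conjugation and basis element $e^{(0)}_0=1$. For $\gamma_k\in\{1,-1\}$, $\mathcal A_{k+1}=\mathcal A_k\{\gamma_k\}$ consists of pairs $(a,b)$ of elements of $\mathcal A_k$ with componentwise linear operations, product $(a,b)(c,d)=(ac+\gamma_k\bar d b,\ da+b\bar c)$ and conjugation $\overline{(a,b)}=(\bar a,-b)$; $\mathcal A_m\{\gamma_0,\dots,\gamma_{m-1}\}$ denotes the algebra obtained from $\mathbb R$ with successive parameters $\gamma_0,\dots,\gamma_{m-1}$. For $\gamma=(\gamma_0,\dots,\gamma_n)$ put $\mathcal A_{n+1}=\mathcal A^{\gamma}_{n+1}=\mathcal A_{n+1}\{\gamma_0,\dots,\gamma_n\}$, $\mathcal A_n^{\circ}=\mathcal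 A_n^{\gamma,\circ}=\mathcal A_n\{\gamma_0,\dots,\gamma_{n-2},\gamma_n\}$ and $\mathcal A_n^{\bullet}=\mathcal A_n^{\gamma,\bullet}=\mathcal A_n\{\gamma_0,\dots,\gamma_{n-2},\gamma_{n-1}\gamma_n\}$. The standard basis of $\mathcal A_{k+1}$ is $e^{(k+1)}_j=(e^{(k)}_j,0)$ for $0\le j<2^k$ and $e^{(k+1)}_j=(0,e^{(k)}_{j-2^k})$ for $2^k\le j<2^{k+1}$. $\mathcal E_m$ is the standard basis of $\mathcal A_m$, $e_0$ is the unit, $\mathcal E'_m=\mathcal E_m\setminus\{e_0\}$. Two elements $u,v$ of an algebra are orthogonal if $uv=vu=0$. For any Cayley–Dickson algebra $\mathcal A_{m+1}=\mathcal A_m\{\gamma_m\}$, the graph $\Gamma_e(\mathcal A_{m+1})$ has as vertices the lines $\mathbb R(a,b)\subset\mathcal A_{m+1}$ spanned by zero divisors $(a,b)$ with $a\in\mathcal E'_m$, $b\in\pm\mathcal E_m$; two distinct lines are adjacent iff their generators are orthogonal. *)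

theory Defs
  imports Complex_Main
begin

(* An element of the m-th Cayley-Dickson algebra is a complete binary tree of depth m with real
   leaves, i.e. an m-fold iterated pair; cd_carrier m is the set of these trees. On arguments of
   different depths the operations below have no meaning. *)

datatype cd = Sc real | Pr cd cd

primrec cd_carrier :: "nat \<Rightarrow> cd set" where
  "cd_carrier 0 = range Sc"
| "cd_carrier (Suc k) = {Pr a b | a b. a \<in> cd_carrier k \<and> b \<in> cd_carrier k}"

primrec cd_zero :: "nat \<Rightarrow> cd" where
  "cd_zero 0 = Sc 0"
| "cd_zero (Suc k) = Pr (cd_zero k) (cd_zero k)"

fun cd_add :: "cd \<Rightarrow> cd \<Rightarrow> cd" where
  "cd_add (Sc a) (Sc b) = Sc (a + b)"
| "cd_add (Pr a b) (Pr c d) = Pr (cd_add a c) (cd_add b d)"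

primrec cd_scale :: "real \<Rightarrow> cd \<Rightarrow> cd" where
  "cd_scale r (Sc a) = Sc (r * a)"
| "cd_scale r (Pr a b) = Pr (cd_scale r a) (cd_scale r b)"

definition cd_neg :: "cd \<Rightarrow> cd" where
  "cd_neg x = cd_scale (-1) x"

primrec cd_conj :: "cd \<Rightarrow> cd" where
  "cd_conj (Sc a) = Sc a"
| "cd_conj (Pr a b) = Pr (cd_conj a) (cd_neg b)"

(* cd_mul g m is the product of the algebra obtained from the reals with the successive
   parameters g 0, ..., g (m - 1); the other values of g are not used. *)

fun cd_mul :: "(nat \<Rightarrow> real) \<Rightarrow> nat \<Rightarrow> cd \<Rightarrow> cd \<Rightarrow> cd" where
  "cd_mul g 0 (Sc a) (Sc b) = Sc (a * b)"
| "cd_mul g (Suc k) (Pr a b) (Pr c d) =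
     Pr (cd_add (cd_mul g k a c) (cd_scale (g k) (cd_mul g k (cd_conj d) b)))
        (cd_add (cd_mul g k d a) (cd_mul g k b (cd_conj c)))"

primrec cd_e :: "nat \<Rightarrow> nat \<Rightarrow> cd" where
  "cd_e 0 j = Sc 1"
| "cd_e (Suc k) j =
     (if j < 2 ^ k then Pr (cd_e k j) (cd_zero k) else Pr (cd_zero k) (cd_e k (j - 2 ^ k)))"

definition cd_basis :: "nat \<Rightarrow> cd set" where
  "cd_basis m = cd_e m ` {..<2 ^ m}"

definition cd_basis' :: "nat \<Rightarrow> cd set" where
  "cd_basis' m = cd_basis m - {cd_e m 0}"

definition cd_signed_basis :: "nat \<Rightarrow> cd set" where
  "cd_signed_basis m = cd_basis m \<union> cd_neg ` cd_basis m"

(* For the elements (a, b) with a in cd_basis' used below it does not matter whether left, right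
   or two-sided zero divisors are meant: such an x satisfies cd_conj x = cd_neg x, so conjugation
   turns x y = 0 into cd_conj y x = 0 and back. *)

definition cd_zero_divisor :: "(nat \<Rightarrow> real) \<Rightarrow> nat \<Rightarrow> cd \<Rightarrow> bool" where
  "cd_zero_divisor g m x \<longleftrightarrow>
     x \<in> cd_carrier m \<and> x \<noteq> cd_zero m \<and>
     (\<exists>y \<in> cd_carrier m. y \<noteq> cd_zero m \<and>
        (cd_mul g m x y = cd_zero m \<or> cd_mul g m y x = cd_zero m))"

definition cd_orth :: "(nat \<Rightarrow> real) \<Rightarrow> nat \<Rightarrow> cd \<Rightarrow> cd \<Rightarrow> bool" where
  "cd_orth g m u v \<longleftrightarrow> cd_mul g m u v = cd_zero m \<and> cd_mul g m v u = cd_zero m"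

definition cd_line :: "cd \<Rightarrow> cd set" where
  "cd_line x = range (\<lambda>r. cd_scale r x)"

(* A simple graph is a pair of a vertex set and a set of two-element edges. The next three
   definitions are meant for m \<ge> 1 and describe the graph of the m-th algebra, whose elements
   are pairs over the (m - 1)-st one. Orthogonality does not depend on the chosen generators,
   as these are unique up to a nonzero factor. *)

definition gamma_e_verts :: "(nat \<Rightarrow> real) \<Rightarrow> nat \<Rightarrow> cd set set" where
  "gamma_e_verts g m =
     {cd_line (Pr a b) | a b. a \<in> cd_basis' (m - 1) \<and> b \<in> cd_signed_basis (m - 1) \<and>
        cd_zero_divisor g m (Pr a b)}"

definition gamma_e_edges :: "(nat \<Rightarrow> real) \<Rightarrow> nat \<Rightarrow> cd set set set" where
  "gamma_e_edges g m =
     {{K, L} | K L. K \<in> gamma_e_verts g m \<and> L \<in> gamma_e_verts g m \<and> K \<noteq> L \<and>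
        (\<exists>u v. K = cd_line u \<and> L = cd_line v \<and> cd_orth g m u v)}"

definition gamma_e :: "(nat \<Rightarrow> real) \<Rightarrow> nat \<Rightarrow> cd set set \<times> cd set set set" where
  "gamma_e g m = (gamma_e_verts g m, gamma_e_edges g m)"

definition graph_iso :: "'a set \<times> 'a set set \<Rightarrow> 'b set \<times> 'b set set \<Rightarrow> bool" where
  "graph_iso G H \<longleftrightarrow>
     (\<exists>f. bij_betw f (fst G) (fst H) \<and>
        (\<forall>x \<in> fst G. \<forall>y \<in> fst G. {x, y} \<in> snd G \<longleftrightarrow> {f x, f y} \<in> snd H))"

(* Parameters of the two n-th algebras derived from g 0, ..., g n; for n \<ge> 1, position n - 1 is
   the last one used at level n. *)

definition circ_params :: "nat \<Rightarrow> (nat \<Rightarrow> real) \<Rightarrow> nat \<Rightarrow> real" where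
  "circ_params n g = g(n - 1 := g n)"

definition bullet_params :: "nat \<Rightarrow> (nat \<Rightarrow> real) \<Rightarrow> nat \<Rightarrow> real" where
  "bullet_params n g = g(n - 1 := g (n - 1) * g n)"

end

theory Submission imports Defs
begin

text \<open>
  Basis elements are indexed by bit vectors, so that \<open>e\<^sub>i e\<^sub>j = \<plusminus> e\<^sub>i\<^sub>+\<^sub>j\<close> with addition over the field
  with two elements. Vertices \<open>(e\<^sub>i, \<plusminus> e\<^sub>i\<^sub>+\<^sub>t)\<close> with different \<open>t\<close> are never adjacent. For a fixed \<open>t\<close>, whether
  \<open>i\<close> and \<open>k\<close> are adjacent depends only on the sign of the square of \<open>(0, e\<^sub>t)\<close> and on the first member
  of a complete flag of subspaces, determined by \<open>t\<close>, that meets the span of \<open>i\<close> and \<open>k\<close> nontrivially.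
  The binary digits of the degree of a vertex therefore spell out the edge signs along this flag, and the
  number of vertices of each degree determines the parameters \<open>\<gamma>\<^sub>3, \<dots>, \<gamma>\<^sub>n\<close> and whether the octonion
  subalgebra spanned by the first eight basis elements is split. This fixes the algebras \<open>A\<^sub>n\<^sup>\<circ>\<close> and
  \<open>A\<^sub>n\<^sup>\<bullet>\<close> up to an isomorphism that permutes the basis up to signs, hence their graphs.
\<close>

section \<open>Cayley-Dickson arithmetic on the standard basis\<close>

text \<open>A degree reveals the sign of the square of \<open>(0, e_t)\<close>, as its lowest digit
  belongs to the first member of the flag, where the edge sign is always 1. It need not reveal
  \<open>t\<close>. All digits from the level of \<open>i\<close> on repeat one sign, so small
  levels of different \<open>t\<close> can collide; and the seven \<open>t\<close> with
  \<open>t div 8 = y\<close> and \<open>t mod 8 \<noteq> 0\<close> have the same signs along their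
  flags. The first defect is avoided by using odd \<open>y\<close> only. The second one shapes the
  counting: what remains visible is the number of \<open>x\<close> in \<open>{1..7}\<close> at which
  the norm form has a given sign on \<open>e_x\<close>. The norm form is a character on the index
  vectors, trivial on the first eight exactly in the definite case, so this number is 7, 0, 3 or 4,
  and these values separate both cases and both signs contributed by \<open>8 * y\<close>. The
  choices \<open>y = 1\<close> and \<open>y = 2 ^ (b - 3) + 1\<close> then isolate the parameters at
  positions 3 to \<open>n - 1\<close>, while position \<open>n\<close> is read off from the vertices
  of the largest degree. As \<open>n - 1\<close> is at least 3, passing to the derived sequences
  changes no entry among the first three, which are known only up to isomorphism of the octonion
  algebra.\<close>

lemma carrier_zero: "cd_zero m \<in> cd_carrier m"
  by (induction m) auto

lemma carrier_add:
  "x \<in> cd_carrier m \<Longrightarrow> y \<in> cd_carrier m \<Longrightarrow> cd_add x y \<in> cd_carrier m"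
  by (induction m arbitrary: x y) auto

lemma carrier_scale: "x \<in> cd_carrier m \<Longrightarrow> cd_scale r x \<in> cd_carrier m"
  by (induction m arbitrary: x) auto

lemma carrier_neg: "x \<in> cd_carrier m \<Longrightarrow> cd_neg x \<in> cd_carrier m"
  by (simp add: cd_neg_def carrier_scale)

lemma carrier_conj: "x \<in> cd_carrier m \<Longrightarrow> cd_conj x \<in> cd_carrier m"
  by (induction m arbitrary: x) (auto simp: carrier_neg)

lemma carrier_mul:
  "x \<in> cd_carrier m \<Longrightarrow> y \<in> cd_carrier m \<Longrightarrow> cd_mul g m x y \<in> cd_carrier m"
  by (induction m arbitrary: x y) (auto simp: carrier_add carrier_scale carrier_conj)

lemma carrier_e: "cd_e m j \<in> cd_carrier m"
  by (induction m arbitrary: j) (auto simp: carrier_zero)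

lemmas carrier_closed = carrier_zero carrier_add carrier_scale carrier_neg carrier_conj carrier_mul carrier_e

lemma add_zero_left: "x \<in> cd_carrier m \<Longrightarrow> cd_add (cd_zero m) x = x"
  by (induction m arbitrary: x) auto

lemma add_zero_right: "x \<in> cd_carrier m \<Longrightarrow> cd_add x (cd_zero m) = x"
  by (induction m arbitrary: x) auto

lemma scale_scale [simp]: "cd_scale r (cd_scale s x) = cd_scale (r * s) x"
  by (induction x) (auto simp: mult.assoc)

lemma scale_1 [simp]: "cd_scale 1 x = x"
  by (induction x) auto

lemma scale_cd_zero [simp]: "cd_scale r (cd_zero m) = cd_zero m"
  by (induction m) auto

lemma scale_0: "x \<in> cd_carrier m \<Longrightarrow> cd_scale 0 x = cd_zero m"
  by (induction m arbitrary: x) auto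

lemma scale_add:
  "x \<in> cd_carrier m \<Longrightarrow> y \<in> cd_carrier m \<Longrightarrow>
   cd_scale r (cd_add x y) = cd_add (cd_scale r x) (cd_scale r y)"
  by (induction m arbitrary: x y) (auto simp: algebra_simps)

lemma add_scale_scale: "cd_add (cd_scale r x) (cd_scale s x) = cd_scale (r + s) x"
  by (induction x) (auto simp: algebra_simps)

lemma conj_scale: "cd_conj (cd_scale r x) = cd_scale r (cd_conj x)"
  by (induction x) (auto simp: cd_neg_def mult.commute)

lemma conj_cd_zero [simp]: "cd_conj (cd_zero m) = cd_zero m"
  by (induction m) (auto simp: cd_neg_def)

lemma mul_scale_left:
  "x \<in> cd_carrier m \<Longrightarrow> y \<in> cd_carrier m \<Longrightarrow>
   cd_mul g m (cd_scale r x) y = cd_scale r (cd_mul g m x y)"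
  and mul_scale_right:
  "x \<in> cd_carrier m \<Longrightarrow> y \<in> cd_carrier m \<Longrightarrow>
   cd_mul g m x (cd_scale r y) = cd_scale r (cd_mul g m x y)"
proof (induction m arbitrary: x y)
  case 0
  { case 1 then show ?case by auto next case 2 then show ?case by auto }
next
  case (Suc m)
  { case 1
    then show ?case
      by (auto simp: Suc carrier_closed scale_add[of _ m] mult.commute) 
  next
    case 2
    then show ?case
      by (auto simp: Suc carrier_closed scale_add[of _ m] conj_scale mult.commute) }
qed

lemma mul_zero_left: "y \<in> cd_carrier m \<Longrightarrow> cd_mul g m (cd_zero m) y = cd_zero m"
  using mul_scale_left[of "cd_zero m" m y g 0]
  by (metis carrier_zero carrier_mul scale_0 scale_cd_zero)

lemma mul_zero_right: "x \<in> cd_carrier m \<Longrightarrow> cd_mul g m x (cd_zero m) = cd_zero m"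
  using mul_scale_right[of x m "cd_zero m" g 0]
  by (metis carrier_zero carrier_mul scale_0 scale_cd_zero)

definition conj_sign :: "nat \<Rightarrow> real" where
  "conj_sign j = (if j = 0 then 1 else - 1)"

text \<open>The sign of \<open>e_i e_j\<close>. The branches are the four products of pairs with one
  nonzero component each; the exchanged arguments come from the terms \<open>d a\<close> and
  (conjugate of \<open>d\<close>) times \<open>b\<close>.\<close>

primrec eps :: "(nat \<Rightarrow> real) \<Rightarrow> nat \<Rightarrow> nat \<Rightarrow> nat \<Rightarrow> real" where
  "eps g 0 i j = 1"
| "eps g (Suc k) i j =
     (if i < 2 ^ k then (if j < 2 ^ k then eps g k i j else eps g k (j - 2 ^ k) i)
      else if j < 2 ^ k then conj_sign j * eps g k (i - 2 ^ k) j
      else g k * conj_sign (j - 2 ^ k) * eps g k (j - 2 ^ k) (i - 2 ^ k))"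

lemma conj_sign_0 [simp]: "conj_sign 0 = 1" and conj_sign_pos [simp]: "0 < j \<Longrightarrow> conj_sign j = -1"
  by (auto simp: conj_sign_def)

lemma conj_sign_sq [simp]: "conj_sign j * conj_sign j = 1" "conj_sign j * (conj_sign j * z) = z"
  by (auto simp: conj_sign_def)

lemma xor_less: "i < 2 ^ k \<Longrightarrow> j < 2 ^ k \<Longrightarrow> xor i j < (2::nat) ^ k"
  by (metis take_bit_nat_eq_self_iff take_bit_xor)

lemma top_plus_eq_xor:
  assumes "i < (2::nat) ^ k"
  shows "2 ^ k + i = xor (2 ^ k) i"
proof (rule disjunctive_add_eq_xor, rule bit_eqI)
  fix n
  show "bit (and (2 ^ k) i) n = bit 0 n"
    using assms by (metis bit_and_iff bit_exp_iff bit_0_eq bot_apply bot_bool_def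
        take_bit_nat_eq_self_iff bit_take_bit_iff less_irrefl)
qed

lemma xor_top_low: "i < 2 ^ k \<Longrightarrow> j < 2 ^ k \<Longrightarrow> xor (2 ^ k + i) j = (2::nat) ^ k + xor i j"
  by (simp add: top_plus_eq_xor xor_less xor.assoc)

lemma xor_low_top: "i < 2 ^ k \<Longrightarrow> j < 2 ^ k \<Longrightarrow> xor i (2 ^ k + j) = (2::nat) ^ k + xor i j"
  by (simp add: top_plus_eq_xor xor_less xor.left_commute)

lemma xor_self_left [simp]: "xor a (xor a b) = (b::nat)"
  by (metis xor.assoc xor_self_eq xor.left_neutral)

lemma xor_top_top: "i < 2 ^ k \<Longrightarrow> j < 2 ^ k \<Longrightarrow> xor (2 ^ k + i) (2 ^ k + j) = (xor i j :: nat)"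
  by (simp add: top_plus_eq_xor xor_less xor.assoc xor.left_commute)

lemma xor_eq_0 [simp]: "xor a b = 0 \<longleftrightarrow> a = (b::nat)"
  by (metis xor_self_eq xor_self_left xor.right_neutral)

lemma conj_e: "j < 2 ^ m \<Longrightarrow> cd_conj (cd_e m j) = cd_scale (conj_sign j) (cd_e m j)"
proof (induction m arbitrary: j)
  case (Suc m)
  show ?case
  proof (cases "j < 2 ^ m")
    case True
    then show ?thesis using Suc.IH[OF True] by (simp add: cd_neg_def)
  next
    case False
    then have "0 < j" by (metis neq0_conv zero_less_power zero_less_numeral)
    with False show ?thesis by (simp add: cd_neg_def)
  qed
qed auto

lemma mul_e:
  "i < 2 ^ m \<Longrightarrow> j < 2 ^ m \<Longrightarrow>
   cd_mul g m (cd_e m i) (cd_e m j) = cd_scale (eps g m i j) (cd_e m (xor i j))"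
proof (induction m arbitrary: i j)
  case (Suc m)
  note z = add_zero_left[of _ m] add_zero_right[of _ m] mul_zero_left mul_zero_right carrier_closed
    mul_scale_left[of _ m] mul_scale_right[of _ m] conj_e
  consider "i < 2 ^ m" "j < 2 ^ m" | j' where "i < 2 ^ m" "j = 2 ^ m + j'" "j' < 2 ^ m"
    | i' where "i = 2 ^ m + i'" "j < 2 ^ m" "i' < 2 ^ m"
    | i' j' where "i = 2 ^ m + i'" "j = 2 ^ m + j'" "i' < 2 ^ m" "j' < 2 ^ m"
    using Suc.prems
    by (metis add_less_cancel_left le_add_diff_inverse mult_2 not_less power_Suc)
  then show ?case
  proof cases
    case 1 then show ?thesis using Suc.IH[of i j] by (simp add: z xor_less)
  next
    case 2 then show ?thesis using Suc.IH[of j' i]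
      by (simp add: z xor_low_top xor.commute) 
  next
    case 3 then show ?thesis using Suc.IH[of i' j]
      by (simp add: z xor_top_low) 
  next
    case 4 then show ?thesis using Suc.IH[of j' i']
      by (simp add: z xor_top_top xor_less xor.commute mult_ac) 
  qed
qed auto

section \<open>Sign identities\<close>

lemma eps_ll: "i < 2 ^ k \<Longrightarrow> j < 2 ^ k \<Longrightarrow> eps g (Suc k) i j = eps g k i j"
  and eps_lh: "i < 2 ^ k \<Longrightarrow> j < 2 ^ k \<Longrightarrow> eps g (Suc k) i (2 ^ k + j) = eps g k j i"
  and eps_hl: "i < 2 ^ k \<Longrightarrow> j < 2 ^ k \<Longrightarrow> eps g (Suc k) (2 ^ k + i) j = conj_sign j * eps g k i j"
  and eps_hh: "i < 2 ^ k \<Longrightarrow> j < 2 ^ k \<Longrightarrow>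
    eps g (Suc k) (2 ^ k + i) (2 ^ k + j) = g k * conj_sign j * eps g k j i"
  by auto

lemmas eps_top = eps_ll eps_lh eps_hl eps_hh
lemmas xor_top = xor_low_top xor_top_low xor_top_top

lemma less_Suc_pow_cases:
  assumes "i < (2::nat) ^ Suc m"
  obtains (low) "i < 2 ^ m" | (high) i' where "i = 2 ^ m + i'" "i' < 2 ^ m"
  using assms by (metis add_less_cancel_left le_add_diff_inverse mult_2 not_less power_Suc)

lemma eps_0: "j < 2 ^ n \<Longrightarrow> eps g n 0 j = 1 \<and> eps g n j 0 = 1"
proof (induction n arbitrary: j)
  case (Suc n)
  from Suc.prems show ?case
  proof (cases rule: less_Suc_pow_cases)
    case low then show ?thesis using Suc.IH by simp
  next
    case (high i')
    then show ?thesis using Suc.IH[of i'] by simp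
  qed
qed auto

lemma conj_sign_top [simp]: "conj_sign (2 ^ m + i) = -1"
  by (simp add: conj_sign_def)

context
  fixes g :: "nat \<Rightarrow> real" and n :: nat
  assumes g: "\<forall>b<n. g b \<in> {1, -1}"
begin

lemma eps_sq: "i < 2 ^ n \<Longrightarrow> j < 2 ^ n \<Longrightarrow> eps g n i j * eps g n i j = 1"
  using g
proof (induction n arbitrary: i j)
  case (Suc n)
  have gn: "g n * g n = 1" "\<forall>b<n. g b \<in> {1, -1}" using Suc.prems(3) by auto
  note IH = Suc.IH[OF _ _ gn(2)]
  have gn': "g n * (g n * z) = z" for z using gn(1) by (simp add: mult.assoc[symmetric])
  have IH': "i < 2 ^ n \<Longrightarrow> j < 2 ^ n \<Longrightarrow> eps g n i j * (eps g n i j * z) = z" for i j z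
    using IH by (simp add: mult.assoc[symmetric])
  from Suc.prems(1) show ?case
  proof (cases rule: less_Suc_pow_cases)
    case low
    from Suc.prems(2) show ?thesis
      by (cases rule: less_Suc_pow_cases) (use low IH in auto)
  next
    case (high i')
    from Suc.prems(2) show ?thesis
      by (cases rule: less_Suc_pow_cases) (use high IH IH' gn gn' in \<open>auto simp: mult_ac\<close>)
  qed
qed auto

lemma eps_sq': "i < 2 ^ n \<Longrightarrow> j < 2 ^ n \<Longrightarrow> eps g n i j * (eps g n i j * z) = z"
  using eps_sq by (simp add: mult.assoc[symmetric])

lemma eps_pm: "i < 2 ^ n \<Longrightarrow> j < 2 ^ n \<Longrightarrow> eps g n i j = 1 \<or> eps g n i j = -1"
  using eps_sq square_eq_1_iff by blast

end

text \<open>Conjugation reverses products; this is that law on basis elements.\<close>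

lemma eps_comm:
  "i < 2 ^ n \<Longrightarrow> j < 2 ^ n \<Longrightarrow> eps g n i j = conj_sign i * conj_sign j * conj_sign (xor i j) * eps g n j i"
proof (induction n arbitrary: i j)
  case (Suc n)
  from Suc.prems(1) show ?case
  proof (cases rule: less_Suc_pow_cases)
    case low
    from Suc.prems(2) show ?thesis
    proof (cases rule: less_Suc_pow_cases)
      case (high j')
      then show ?thesis using low by (simp add: xor_top)
    next
      case low2: low
      show ?thesis unfolding eps_ll[OF low low2] eps_ll[OF low2 low] by (rule Suc.IH[OF low low2])
    qed
  next
    case (high i')
    from Suc.prems(2) show ?thesis
    proof (cases rule: less_Suc_pow_cases)
      case low
      then show ?thesis using high by (simp add: xor_top)
    next
      case (high j')
      note hi = \<open>i = _\<close> \<open>i' < _\<close>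
      have "g n * conj_sign j' * eps g n j' i' = (-1) * (-1) * conj_sign (xor i' j') * (g n * conj_sign i' * eps g n i' j')"
        using Suc.IH[OF hi(2) high(2)] conj_sign_sq(1)[of i'] conj_sign_sq(1)[of j'] conj_sign_sq(1)[of "xor i' j'"]
        by algebra
      then show ?thesis by (simp only: eps_top xor_top conj_sign_top hi high)
    qed
  qed
qed auto

text \<open>The alternative laws \<open>e_t (e_t x) = (e_t e_t) x\<close> and
  \<open>(x e_t) e_t = x (e_t e_t)\<close> as sign identities. For general elements they fail from
  dimension sixteen on, but basis elements keep them in every dimension.\<close>

lemma eps_alt:
  assumes "\<forall>b<n. g b \<in> {1, -1}" "i < 2 ^ n" "t < 2 ^ n"
  shows "eps g n t i * eps g n t (xor i t) = eps g n t t \<and>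
    eps g n i t * eps g n (xor i t) t = eps g n t t"
  using assms
proof (induction n arbitrary: i t)
  case 0
  then show ?case by simp
next
  case (Suc n)
  have g': "\<forall>b<n. g b \<in> {1, -1}" using Suc.prems(1) by auto
  note top = eps_top xor_top xor_less
  note IH = Suc.IH[OF g']
  have sq: "conj_sign j * conj_sign j = 1" for j by simp
  from Suc.prems(2) show ?case
  proof (cases rule: less_Suc_pow_cases)
    case low
    from Suc.prems(3) show ?thesis
    proof (cases rule: less_Suc_pow_cases)
      case low2: low
      show ?thesis using IH[OF low low2] by (simp only: top low low2)
    next
      case (high t')
      have "conj_sign i * eps g n t' i * (g n * conj_sign (xor i t') * eps g n (xor i t') t') = g n * conj_sign t' * eps g n t' t'"
        using eps_comm[OF low high(2), of g] IH[OF low high(2)]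
          sq[of i] sq[of t'] sq[of "xor i t'"] by algebra
      moreover have "eps g n t' i * (g n * conj_sign t' * eps g n t' (xor i t')) = g n * conj_sign t' * eps g n t' t'"
        unfolding conjunct1[OF IH[OF low high(2)], symmetric] by (simp only: mult_ac)
      ultimately show ?thesis by (simp only: top low high)
    qed
  next
    case (high i')
    note hi = high
    from Suc.prems(3) show ?thesis
    proof (cases rule: less_Suc_pow_cases)
      case low
      have "conj_sign t * eps g n i' t * (conj_sign t * eps g n (xor i' t) t) = eps g n t t"
        unfolding conjunct2[OF IH[OF hi(2) low], symmetric] by (simp add: mult_ac)
      then show ?thesis using IH[OF hi(2) low] by (simp only: top low hi)
    next
      case (high t')
      have "g n * conj_sign i' * eps g n i' t' * (conj_sign (xor i' t') * eps g n t' (xor i' t')) = g n * conj_sign t' * eps g n t' t'"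
        using eps_comm[OF hi(2) high(2), of g] IH[OF hi(2) high(2)]
          sq[of i'] sq[of t'] sq[of "xor i' t'"] by algebra
      moreover have "g n * conj_sign t' * eps g n t' i' * eps g n t' (xor i' t') = g n * conj_sign t' * eps g n t' t'"
        unfolding conjunct1[OF IH[OF hi(2) high(2)], symmetric] by (simp only: mult_ac)
      ultimately show ?thesis by (simp only: top hi high)
    qed
  qed
qed

text \<open>Generators \<open>(e\<^sub>i, \<plusminus> e\<^sub>i\<^sub>+\<^sub>t)\<close> and \<open>(e\<^sub>k, \<plusminus> e\<^sub>k\<^sub>+\<^sub>t)\<close> are orthogonal, for a suitable relation of the two
  signs, iff this is the sign of the square of \<open>(0, e\<^sub>t)\<close>. The parameters cancel in the product.\<close>

definition edge_sign :: "(nat \<Rightarrow> real) \<Rightarrow> nat \<Rightarrow> nat \<Rightarrow> nat \<Rightarrow> nat \<Rightarrow> real" where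
  "edge_sign g n t i k = conj_sign t * conj_sign k * conj_sign (xor k t) * eps g n t t * eps g n (xor k t) i *
     eps g n (xor i t) k * eps g n i k * eps g n (xor k t) (xor i t)"

lemma xor_xor_right [simp]: "xor (xor a b) b = (a::nat)" "xor (xor b a) b = (a::nat)" "xor b (xor a b) = a"
  by (metis xor.commute xor_self_left)+

lemma xor_eq_right [simp]: "xor a b = b \<longleftrightarrow> a = (0::nat)" "xor b a = b \<longleftrightarrow> a = (0::nat)"
  by (metis xor_self_left xor_eq_0 xor.right_neutral xor.commute)+

section \<open>Symmetries of the edge sign and linearly dependent triples\<close>

context
  fixes g :: "nat \<Rightarrow> real" and n :: nat
  assumes g: "\<forall>b<n. g b \<in> {1, -1}"
begin

lemma edge_sign_sym:
  assumes "t < 2 ^ n" "i < 2 ^ n" "k < 2 ^ n"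
  shows "edge_sign g n t i k = edge_sign g n t k i"
proof -
  have x: "xor (xor k t) (xor i t) = xor k i"
    by (simp add: xor.assoc xor.left_commute xor.commute)
  have 1: "eps g n i k = conj_sign i * conj_sign k * conj_sign (xor k i) * eps g n k i"
    using eps_comm[of i n k g] assms by (simp add: xor.commute)
  have 2: "eps g n (xor k t) (xor i t) = conj_sign (xor k t) * conj_sign (xor i t) * conj_sign (xor k i) * eps g n (xor i t) (xor k t)"
    using eps_comm[of "xor k t" n "xor i t" g] assms by (simp add: xor_less x)
  show ?thesis
    using conj_sign_sq(1)[of i] conj_sign_sq(1)[of k] conj_sign_sq(1)[of "xor k i"] conj_sign_sq(1)[of "xor k t"] conj_sign_sq(1)[of "xor i t"]
    unfolding edge_sign_def 1 2 by algebra
qed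

text \<open>Adding \<open>t\<close> to \<open>i\<close> only permutes the four factors that contain
  \<open>i\<close>. Together with symmetry, the sign depends on \<open>i\<close> and
  \<open>k\<close> only modulo \<open>t\<close>.\<close>

lemma edge_sign_shift:
  assumes "t < 2 ^ n" "i < 2 ^ n" "k < 2 ^ n"
  shows "edge_sign g n t (xor i t) k = edge_sign g n t i k"
  unfolding edge_sign_def by simp

lemma edge_sign_t0:
  assumes "i < 2 ^ n" "k < 2 ^ n"
  shows "edge_sign g n 0 i k = 1"
  using eps_sq[OF g, of i k] eps_sq[OF g, of k i] assms eps_0[of 0 n g] conj_sign_sq(1)[of k]
  unfolding edge_sign_def xor.right_neutral conj_sign_0 by simp algebra

lemma edge_sign_0:
  assumes "t < 2 ^ n" "k < 2 ^ n"
  shows "edge_sign g n t 0 k = 1"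
proof -
  have a: "eps g n t t = eps g n k t * eps g n (xor k t) t"
    using eps_alt[OF g] assms by simp
  have "eps g n (xor k t) 0 = 1" "eps g n 0 k = 1"
    using eps_0 xor_less assms by blast+
  moreover have "eps g n t k = conj_sign t * conj_sign k * conj_sign (xor k t) * eps g n k t"
    using eps_comm[of t n k g] assms by (simp add: xor.commute)
  moreover note eps_sq[OF g assms(2,1)] eps_sq[OF g xor_less[OF assms(2,1)] assms(1)]
    conj_sign_sq(1)[of t] conj_sign_sq(1)[of k] conj_sign_sq(1)[of "xor k t"]
  ultimately show ?thesis
    unfolding edge_sign_def xor.left_neutral a by algebra
qed

lemma edge_sign_t:
  assumes "t < 2 ^ n" "k < 2 ^ n"
  shows "edge_sign g n t t k = 1"
  using edge_sign_shift[of t 0 k] edge_sign_0 assms by simp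

text \<open>With \<open>u = xor k t\<close>, the elements \<open>e_t\<close>, \<open>e_k\<close>,
  \<open>e_u\<close> are imaginary units of a quaternion algebra, where the signs of the three
  squares multiply to -1.\<close>

lemma edge_sign_same:
  assumes "t < 2 ^ n" "k < 2 ^ n" "t \<noteq> 0" "k \<noteq> 0"
  shows "edge_sign g n t k k = 1"
proof (cases "k = t")
  case True
  then show ?thesis using edge_sign_t assms by simp
next
  case False
  define u where "u = xor k t"
  have u: "u < 2 ^ n" "u \<noteq> 0" "xor u t = k" "xor u k = t" "xor t k = u" "xor t u = k" 
    using assms False by (auto simp: u_def xor_less xor.commute)
  have f: "edge_sign g n t k k = - eps g n t t * eps g n k k * eps g n u u"
    using assms u eps_sq[OF g, of u k] unfolding edge_sign_def u_def[symmetric] 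
    by simp
  have a: "eps g n t t = eps g n t k * eps g n t u"
    using eps_alt[OF g, of k t] assms by (simp add: u_def)
  have b: "eps g n k k = eps g n k t * eps g n k u"
    using eps_alt[OF g, of t k] assms u by simp
  have c: "eps g n u u = eps g n u t * eps g n u k"
    using eps_alt[OF g, of t u] assms u by simp
  have sw: "eps g n k t = - eps g n t k" "eps g n u t = - eps g n t u" "eps g n u k = - eps g n k u"
    using eps_comm[of k n t g] eps_comm[of u n t g] eps_comm[of u n k g] assms u
    by (simp_all add: u_def[symmetric])
  show ?thesis unfolding f a b c sw
    using eps_sq[OF g] eps_sq'[OF g] assms(1,2) u(1) by (simp add: mult_ac)
qed

text \<open>Here \<open>t\<close>, \<open>i\<close>, \<open>k\<close> are dependent over the field
  with two elements: modulo \<open>t\<close>, one of \<open>i\<close>, \<open>k\<close> vanishes or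
  both agree. Symmetry and shift thus leave only \<open>i = 0\<close> and
  \<open>i = k\<close>.\<close>

lemma edge_sign_degenerate:
  assumes "t < 2 ^ n" "i < 2 ^ n" "k < 2 ^ n" "t \<noteq> 0"
   and "i \<in> {0, t} \<or> k \<in> {0, t} \<or> xor i k \<in> {0, t}"
  shows "edge_sign g n t i k = 1"
proof -
  have eq1: "edge_sign g n t k k = 1"
  proof (cases "k = 0")
    case True
    then show ?thesis using edge_sign_0[OF assms(1,3)] by simp
  qed (rule edge_sign_same[OF assms(1,3,4)])
  have eq: "edge_sign g n t k k = 1" "edge_sign g n t (xor k t) k = 1"
    by (rule eq1) (simp only: edge_sign_shift[OF assms(1,3,3)] eq1)
  have z: "edge_sign g n t i 0 = 1" "edge_sign g n t i t = 1"
    using edge_sign_sym[OF assms(1,2)] edge_sign_0[OF assms(1,2)] edge_sign_t[OF assms(1,2)] assms(1) by simp_all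
  from assms(5) consider "i = 0" | "i = t" | "k = 0" | "k = t" | "i = k" | "xor i k = t"
    by auto
  then show ?thesis
  proof cases
    case 6
    then have "i = xor k t" by (metis xor_self_left xor.commute)
    then show ?thesis using eq by simp
  qed (use edge_sign_0[OF assms(1,3)] edge_sign_t[OF assms(1,3)] eq z in simp_all)
qed

end

text \<open>The extra factors collect the conjugation signs caused by the top bits. For
  \<open>t \<noteq> 0\<close>, \<open>conj_sign j * conj_sign (xor j t)\<close> is -1 exactly for
  \<open>j\<close> in \<open>{0, t}\<close>, so they matter only where the reduced pair is dependent
  modulo \<open>t\<close>.\<close>

lemma edge_sign_low:
  assumes g: "\<forall>b<Suc m. g b \<in> {1, -1}" and t: "t < 2 ^ m" and i: "i < 2 ^ m" and k: "k < 2 ^ m"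
  shows "edge_sign g (Suc m) t i k = edge_sign g m t i k"
    and "edge_sign g (Suc m) t (2 ^ m + i) k = edge_sign g m t i k * (conj_sign i * conj_sign (xor i t) * conj_sign (xor i k) * conj_sign (xor (xor i k) t))"
    and "edge_sign g (Suc m) t (2 ^ m + i) (2 ^ m + k) = edge_sign g m t i k * (conj_sign k * conj_sign (xor k t) * conj_sign i * conj_sign (xor i t))"
proof -
  note top = eps_top xor_top xor_less conj_sign_top t i k
  have gm: "g m * g m = 1" using g by auto
  then have gm': "g m * (g m * z) = z" for z by (simp add: mult.assoc[symmetric])
  have x: "xor (xor i t) (xor k t) = xor i k" "xor (xor k t) (xor i t) = xor i k"
    "xor (xor k t) i = xor (xor i k) t" "xor i (xor k t) = xor (xor i k) t"
    "xor k (xor i t) = xor (xor i k) t" "xor (xor i t) k = xor (xor i k) t" 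
    "xor k i = xor i k"
    by (simp_all add: xor.assoc xor.left_commute xor.commute)
  have 1: "eps g m i (xor k t) = conj_sign i * conj_sign (xor k t) * conj_sign (xor (xor i k) t) * eps g m (xor k t) i"
    using eps_comm[of i m "xor k t" g] i k t by (simp only: xor_less x)
  have 2: "eps g m (xor i t) (xor k t) = conj_sign (xor i t) * conj_sign (xor k t) * conj_sign (xor i k) * eps g m (xor k t) (xor i t)"
    using eps_comm[of "xor i t" m "xor k t" g] i k t by (simp only: xor_less x)
  have 3: "eps g m k (xor i t) = conj_sign k * conj_sign (xor i t) * conj_sign (xor (xor i k) t) * eps g m (xor i t) k"
    using eps_comm[of k m "xor i t" g] i k t by (simp only: xor_less x)
  have 4: "eps g m k i = conj_sign k * conj_sign i * conj_sign (xor i k) * eps g m i k"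
    using eps_comm[of k m i g] i k t by (simp only: xor_less x)
  show "edge_sign g (Suc m) t i k = edge_sign g m t i k"
    unfolding edge_sign_def by (simp only: top)
  have "edge_sign g (Suc m) t (2 ^ m + i) k = conj_sign t * conj_sign k * conj_sign (xor k t) * eps g m t t *
    eps g m i (xor k t) * (conj_sign k * eps g m (xor i t) k) * (conj_sign k * eps g m i k) * eps g m (xor i t) (xor k t)"
    unfolding edge_sign_def by (simp only: top)
  then show "edge_sign g (Suc m) t (2 ^ m + i) k = edge_sign g m t i k * (conj_sign i * conj_sign (xor i t) * conj_sign (xor i k) * conj_sign (xor (xor i k) t))"
    unfolding edge_sign_def 1 2 by (simp add: mult_ac)
  have "edge_sign g (Suc m) t (2 ^ m + i) (2 ^ m + k) = conj_sign t * (-1) * (-1) * eps g m t t *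
    (g m * conj_sign i * eps g m i (xor k t)) * (g m * conj_sign k * eps g m k (xor i t)) * 
    (g m * conj_sign k * eps g m k i) * (g m * conj_sign (xor i t) * eps g m (xor i t) (xor k t))"
    unfolding edge_sign_def by (simp only: top)
  then show "edge_sign g (Suc m) t (2 ^ m + i) (2 ^ m + k) = edge_sign g m t i k * (conj_sign k * conj_sign (xor k t) * conj_sign i * conj_sign (xor i t))"
    unfolding edge_sign_def 1 2 3 4 by (simp add: mult_ac gm')
qed

text \<open>The top bit of \<open>t\<close> contributes
  \<open>conj_sign i * conj_sign k * conj_sign (xor i k)\<close>, which is -1 because the three
  indices are nonzero. The parameter \<open>g m\<close> enters twice and cancels.\<close>

lemma edge_sign_high:
  assumes g: "\<forall>b<Suc m. g b \<in> {1, -1}" and t: "t < 2 ^ m" and i: "i < 2 ^ m" and k: "k < 2 ^ m"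
    and ik: "i \<noteq> 0" "k \<noteq> 0" "i \<noteq> k"
  shows "edge_sign g (Suc m) (2 ^ m + t) i k = - edge_sign g m t i k"
proof -
  note top = eps_top xor_top xor_less conj_sign_top t i k
  have gm: "g m * g m = 1" using g by auto
  then have gm': "g m * (g m * z) = z" for z by (simp add: mult.assoc[symmetric])
  have x: "xor (xor i t) (xor k t) = xor i k" 
    by (simp_all add: xor.assoc xor.left_commute xor.commute)
  have 2: "eps g m (xor i t) (xor k t) = conj_sign (xor i t) * conj_sign (xor k t) * conj_sign (xor i k) * eps g m (xor k t) (xor i t)"
    using eps_comm[of "xor i t" m "xor k t" g] i k t by (simp only: xor_less x)
  have c: "conj_sign k = -1" "conj_sign i = -1" "conj_sign (xor i k) = -1" using ik by (simp_all add: conj_sign_def)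
  have "edge_sign g (Suc m) (2 ^ m + t) i k = (-1) * conj_sign k * (-1) * (g m * conj_sign t * eps g m t t) *
    (conj_sign i * eps g m (xor k t) i) * (conj_sign k * eps g m (xor i t) k) * eps g m i k *
    (g m * conj_sign (xor i t) * eps g m (xor i t) (xor k t))"
    unfolding edge_sign_def by (simp only: top)
  then show ?thesis unfolding edge_sign_def 2 using c by (simp add: mult_ac gm')
qed

section \<open>Counting neighbours\<close>

definition sgn_of :: "bool \<Rightarrow> real" where
  "sgn_of s = (if s then 1 else -1)"

lemma xor_simps [simp]:
  "0 < xor a b \<longleftrightarrow> a \<noteq> (b::nat)"
  "b = xor a b \<longleftrightarrow> a = (0::nat)"
  "b = xor b a \<longleftrightarrow> a = (0::nat)"
  "xor a c = xor b c \<longleftrightarrow> a = (b::nat)"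
  by (metis neq0_conv xor_eq_0, metis xor_eq_right(1), metis xor_eq_right(2), metis xor_xor_right(1))

lemma sgn_of_eq [simp]: "sgn_of s = 1 \<longleftrightarrow> s" "sgn_of s = -1 \<longleftrightarrow> \<not> s" "1 = sgn_of s \<longleftrightarrow> s" "-1 = sgn_of s \<longleftrightarrow> \<not> s" "- x = sgn_of s \<longleftrightarrow> x = sgn_of (\<not> s)"
  by (auto simp: sgn_of_def)

definition nbr_count :: "(nat \<Rightarrow> real) \<Rightarrow> nat \<Rightarrow> nat \<Rightarrow> nat \<Rightarrow> bool \<Rightarrow> nat" where
  "nbr_count g n t i s = card {k. k < 2 ^ n \<and> k \<notin> {0, i} \<and> edge_sign g n t i k = sgn_of s}"

text \<open>The common value of the edge sign on the pairs whose span meets the \<open>j\<close>-th but not the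
  \<open>(j - 1)\<close>-st subspace of the flag belonging to \<open>t\<close>; \<open>level n t i\<close> is the index of the first
  subspace that contains \<open>i\<close>.\<close>

primrec level_sign :: "nat \<Rightarrow> nat \<Rightarrow> nat \<Rightarrow> bool" where
  "level_sign 0 t j = True"
| "level_sign (Suc m) t j =
     (if t = 0 \<or> j \<le> 1 then True
      else if t < 2 ^ m then j \<noteq> 2 \<and> level_sign m t (j - 1)
      else \<not> level_sign m (t - 2 ^ m) (j - 1))"

primrec level :: "nat \<Rightarrow> nat \<Rightarrow> nat \<Rightarrow> nat" where
  "level 0 t i = 0"
| "level (Suc m) t i =
     (if t = 0 then if i < 2 ^ m then level m 0 i else Suc m
      else if i = 0 \<or> i = t then 1
      else if t < 2 ^ m then Suc (level m t (i mod 2 ^ m))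
      else Suc (level m (t - 2 ^ m) (if i < 2 ^ m then i else xor i t)))"

section \<open>Counting along the two-to-one reductions of the index range\<close>

lemma card_two_halves:
  "card {k. k < (2::nat) ^ Suc m \<and> P k} = card {k. k < 2 ^ m \<and> P k} + card {k. k < 2 ^ m \<and> P (2 ^ m + k)}"
proof -
  have "{k. k < (2::nat) ^ Suc m \<and> P k} = {k. k < 2 ^ m \<and> P k} \<union> (+) (2 ^ m) ` {k. k < 2 ^ m \<and> P (2 ^ m + k)}"
  proof (intro equalityI subsetI)
    fix k
    assume k: "k \<in> {k. k < (2::nat) ^ Suc m \<and> P k}"
    then have "k < 2 ^ Suc m" by simp
    then show "k \<in> {k. k < 2 ^ m \<and> P k} \<union> (+) (2 ^ m) ` {k. k < 2 ^ m \<and> P (2 ^ m + k)}"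
      by (cases rule: less_Suc_pow_cases) (use k in auto)
  qed auto
  moreover have "{k. k < 2 ^ m \<and> P k} \<inter> (+) (2 ^ m) ` {k. k < 2 ^ m \<and> P (2 ^ m + k)} = {}" by auto
  ultimately show ?thesis by (simp add: card_Un_disjoint card_image)
qed

lemma card_mod: "card {k. k < (2::nat) ^ Suc m \<and> P (k mod 2 ^ m)} = 2 * card {k. k < 2 ^ m \<and> P k}"
  unfolding card_two_halves by (simp add: mod_simps cong: conj_cong)

lemma card_xor:
  assumes "t < 2 ^ m"
  shows "card {k. k < (2::nat) ^ m \<and> P (xor k t)} = card {k. k < 2 ^ m \<and> P k}"
  by (rule bij_betw_same_card[of "\<lambda>k. xor k t"], rule bij_betw_byWitness[where f' = "\<lambda>k. xor k t"])
     (use assms xor_less in auto)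

lemma card_fold:
  assumes "t < 2 ^ m"
  shows "card {k. k < (2::nat) ^ Suc m \<and> P (if k < 2 ^ m then k else xor k (2 ^ m + t))} =
    2 * card {k. k < 2 ^ m \<and> P k}"
  unfolding card_two_halves using card_xor[OF assms, of P] assms
  by (simp add: xor_top cong: conj_cong)

context
  fixes g :: "nat \<Rightarrow> real" and m :: nat
  assumes g: "\<forall>b<Suc m. g b \<in> {1, -1}"
begin

text \<open>If a triple is independent only thanks to the top bits, the smaller edge sign is 1 by
  \<open>edge_sign_degenerate\<close>, and exactly one of the two pairs of conjugation signs in
  \<open>edge_sign_low\<close> turns it into -1: both at once would make the original triple
  dependent.\<close>

lemma edge_sign_low':
  assumes t: "t < 2 ^ m" "t \<noteq> 0" and i: "i < 2 ^ Suc m" and k: "k < 2 ^ Suc m"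
    and nd: "i \<notin> {0, t}" "k \<notin> {0, t}" "xor i k \<notin> {0, t}"
  defines "i' \<equiv> i mod 2 ^ m" and "k' \<equiv> k mod 2 ^ m"
  shows "edge_sign g (Suc m) t i k =
    (if i' \<in> {0, t} \<or> k' \<in> {0, t} \<or> xor i' k' \<in> {0, t} then -1 else edge_sign g m t i' k')"
proof -
  have g': "\<forall>b<m. g b \<in> {1, -1}" using g by auto
  have lt: "i' < 2 ^ m" "k' < 2 ^ m" by (auto simp: i'_def k'_def)
  note low = edge_sign_low[OF g t(1) lt] edge_sign_low[OF g t(1) lt(2,1)]
  have tlt: "t < 2 ^ Suc m" using t by simp
  have x: "xor k' i' = xor i' k'" by (rule xor.commute)
  have xt: "xor (xor i' k') t = 0 \<longleftrightarrow> xor i' k' = t" "xor i' t = 0 \<longleftrightarrow> i' = t" "xor k' t = 0 \<longleftrightarrow> k' = t" by auto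
  note dgn = edge_sign_degenerate[OF g' t(1) lt t(2)]
  have csx: "conj_sign j = (if j = 0 then 1 else -1)" for j by (simp add: conj_sign_def)
  consider "i = i'" "k = k'" | "i = 2 ^ m + i'" "k = k'" | "i = i'" "k = 2 ^ m + k'"
    | "i = 2 ^ m + i'" "k = 2 ^ m + k'"
    using i k unfolding i'_def k'_def
    by (metis less_Suc_pow_cases mod_add_self1 mod_less)
  then show ?thesis
  proof cases
    case 1
    then show ?thesis using low(1) nd by simp
  next
    case 2
    have "edge_sign g (Suc m) t i k = edge_sign g m t i' k' * (conj_sign i' * conj_sign (xor i' t) * conj_sign (xor i' k') * conj_sign (xor (xor i' k') t))"
      using low(2) 2 by simp
    then show ?thesis using t(2) nd dgn 2 unfolding csx xt by (auto split: if_splits)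
  next
    case 3
    have "edge_sign g (Suc m) t i k = edge_sign g (Suc m) t k i" using edge_sign_sym[OF g tlt i k] .
    also have "\<dots> = edge_sign g m t k' i' * (conj_sign k' * conj_sign (xor k' t) * conj_sign (xor i' k') * conj_sign (xor (xor i' k') t))"
      using low(5) 3 x by simp
    also have "edge_sign g m t k' i' = edge_sign g m t i' k'" using edge_sign_sym[OF g' t(1) lt] by simp
    finally show ?thesis using t(2) nd dgn 3 unfolding csx xt by (auto split: if_splits)
  next
    case 4
    have "edge_sign g (Suc m) t i k = edge_sign g m t i' k' * (conj_sign k' * conj_sign (xor k' t) * conj_sign i' * conj_sign (xor i' t))"
      using low(3) 4 by simp
    moreover have "xor i k = xor i' k'" using 4 lt by (simp add: xor_top)
    moreover have "i' \<in> {0, t} \<Longrightarrow> k' \<notin> {0, t}"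
      using nd(3) calculation(2) by auto
    ultimately show ?thesis using t(2) nd dgn 4 unfolding csx xt by (auto split: if_splits)
  qed
qed

text \<open>\<open>k'\<close> represents \<open>k\<close> modulo \<open>2 ^ m + t\<close> in the
  lower half, so shift invariance reduces the claim to \<open>edge_sign_high\<close>.\<close>

lemma edge_sign_high':
  assumes t: "t < 2 ^ m" and i: "i < 2 ^ m" "i \<noteq> 0" and k: "k < 2 ^ Suc m"
  defines "k' \<equiv> (if k < 2 ^ m then k else xor k (2 ^ m + t))"
  assumes nd: "k' \<noteq> 0" "k' \<noteq> i"
  shows "edge_sign g (Suc m) (2 ^ m + t) i k = - edge_sign g m t i k'"
proof -
  have lt: "2 ^ m + t < 2 ^ Suc m" "i < 2 ^ Suc m" using t i by auto
  have k': "k' < 2 ^ m" using k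
    by (cases rule: less_Suc_pow_cases) (use t in \<open>auto simp: k'_def xor_top xor_less\<close>)
  have "edge_sign g (Suc m) (2 ^ m + t) i k = edge_sign g (Suc m) (2 ^ m + t) i k'"
  proof (cases "k < 2 ^ m")
    case False
    then have "k' = xor k (2 ^ m + t)" by (simp add: k'_def)
    then show ?thesis
      using edge_sign_sym[OF g lt k] edge_sign_sym[OF g lt, of k'] edge_sign_shift[OF g lt(1) k lt(2)] k'
      by simp
  qed (simp add: k'_def)
  also have "\<dots> = - edge_sign g m t i k'"
    using edge_sign_high[OF g t i(1) k' i(2)] nd by simp
  finally show ?thesis .
qed

end

text \<open>The \<open>k\<close> for which \<open>i\<close>, \<open>k\<close>, \<open>t\<close> are linearly independent over the field with two elements.\<close>

definition indep_nbr_count :: "(nat \<Rightarrow> real) \<Rightarrow> nat \<Rightarrow> nat \<Rightarrow> nat \<Rightarrow> bool \<Rightarrow> nat" where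
  "indep_nbr_count g n t i s = card {k. k < 2 ^ n \<and> k \<notin> {0, t, i, xor i t} \<and> edge_sign g n t i k = sgn_of s}"

text \<open>The dependent \<open>k\<close> other than \<open>0\<close> and \<open>i\<close> are
  \<open>t\<close> and \<open>xor i t\<close>, both with edge sign 1.\<close>

lemma nbr_count_eq_indep:
  assumes g: "\<forall>b<n. g b \<in> {1, -1}" and t: "t < 2 ^ n" "t \<noteq> 0" and i: "i < 2 ^ n" "i \<notin> {0, t}"
  shows "nbr_count g n t i s = indep_nbr_count g n t i s + (if s then 2 else 0)"
proof -
  have it: "xor i t < 2 ^ n" using xor_less t i by blast
  have h: "edge_sign g n t i t = 1" "edge_sign g n t i (xor i t) = 1"
    by (rule edge_sign_degenerate[OF g]; use t i it in auto)+
  let ?E = "{k. k < 2 ^ n \<and> k \<notin> {0, t, i, xor i t} \<and> edge_sign g n t i k = sgn_of s}"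
  have "{k. k < 2 ^ n \<and> k \<notin> {0, i} \<and> edge_sign g n t i k = sgn_of s} = ?E \<union> (if s then {t, xor i t} else {})"
    using h t i it by auto
  moreover have "finite ?E" "?E \<inter> (if s then {t, xor i t} else {}) = {}" by auto
  moreover have "t \<noteq> xor i t" using i by auto
  ultimately show ?thesis by (simp add: nbr_count_def indep_nbr_count_def card_Un_disjoint)
qed

text \<open>Reduction modulo \<open>2 ^ m + t\<close> is two-to-one onto the lower half, sends the
  four excluded vectors to \<open>0\<close> and the reduced \<open>i\<close>, and reverses the edge
  sign elsewhere.\<close>

lemma indep_nbr_count_high:
  assumes g: "\<forall>b<Suc m. g b \<in> {1, -1}" and t: "t < 2 ^ m" and i: "i < 2 ^ Suc m" "i \<notin> {0, 2 ^ m + t}"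
  shows "indep_nbr_count g (Suc m) (2 ^ m + t) i s =
    2 * nbr_count g m t (if i < 2 ^ m then i else xor i (2 ^ m + t)) (\<not> s)"
proof -
  define p where "p k = (if k < 2 ^ m then k else xor k (2 ^ m + t))" for k
  define i' where "i' = p i"
  have p_lt: "p k < 2 ^ m" if "k < 2 ^ Suc m" for k
    using that t by (cases rule: less_Suc_pow_cases) (auto simp: p_def xor_top xor_less)
  have p_eq: "p k = p l \<longleftrightarrow> k = l \<or> k = xor l (2 ^ m + t)" if "k < 2 ^ Suc m" "l < 2 ^ Suc m" for k l
  proof -
    have lo: "xor j (2 ^ m + t) < 2 ^ m \<longleftrightarrow> \<not> j < 2 ^ m" if "j < 2 ^ Suc m" for j
      using that t by (cases rule: less_Suc_pow_cases) (simp_all add: xor_top xor_less)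
    define T where "T = 2 ^ m + t"
    have sw: "xor k T = l \<longleftrightarrow> k = xor l T" "xor k T = xor l T \<longleftrightarrow> k = l" by auto
    show ?thesis
      unfolding p_def using lo[OF that(1)] lo[OF that(2)] sw unfolding T_def[symmetric] by metis
  qed
  have p0: "p 0 = 0" "p k = 0 \<longleftrightarrow> k = 0 \<or> k = 2 ^ m + t" if "k < 2 ^ Suc m" for k
    using p_eq[OF that, of 0] t by (auto simp: p_def)
  have i': "i' < 2 ^ m" "i' \<noteq> 0" using p_lt[OF i(1)] p0(2)[OF i(1)] i(2) by (auto simp: i'_def)
  have tl: "2 ^ m + t < 2 ^ Suc m" using t by simp
  have hi: "edge_sign g (Suc m) (2 ^ m + t) i k = edge_sign g (Suc m) (2 ^ m + t) i' k" if "k < 2 ^ Suc m" for k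
    using edge_sign_shift[OF g tl i(1) that] by (auto simp: i'_def p_def)
  have eq: "{k. k < 2 ^ Suc m \<and> k \<notin> {0, 2 ^ m + t, i, xor i (2 ^ m + t)} \<and> edge_sign g (Suc m) (2 ^ m + t) i k = sgn_of s}
    = {k. k < 2 ^ Suc m \<and> (p k \<notin> {0, i'} \<and> edge_sign g m t i' (p k) = sgn_of (\<not> s))}"
    (is "?L = ?R")
  proof (intro Collect_cong conj_cong refl)
    fix k :: nat assume k: "k < 2 ^ Suc m"
    show "k \<notin> {0, 2 ^ m + t, i, xor i (2 ^ m + t)} \<longleftrightarrow> p k \<notin> {0, i'}"
      using p0(2)[OF k] p_eq[OF k i(1)] by (auto simp: i'_def)
    assume "p k \<notin> {0, i'}"
    then show "edge_sign g (Suc m) (2 ^ m + t) i k = sgn_of s \<longleftrightarrow> edge_sign g m t i' (p k) = sgn_of (\<not> s)"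
      using edge_sign_high'[OF g t i' k] hi[OF k] by (simp add: p_def)
  qed
  show ?thesis
    unfolding indep_nbr_count_def nbr_count_def eq unfolding i'_def p_def
    by (rule card_fold[OF t, where P = "\<lambda>k. k \<notin> {0, i'} \<and> edge_sign g m t i' k = sgn_of (\<not> s)", unfolded i'_def p_def])
qed

text \<open>Dropping the top bit is two-to-one and keeps the sign of triples that stay independent.
  Those that become dependent have sign -1; if \<open>i'\<close> lies in \<open>{0, t}\<close>, this
  happens for every \<open>k\<close>.\<close>

lemma indep_nbr_count_low:
  assumes g: "\<forall>b<Suc m. g b \<in> {1, -1}" and t: "t < 2 ^ m" "t \<noteq> 0" and i: "i < 2 ^ Suc m" "i \<notin> {0, t}"
  defines "i' \<equiv> i mod 2 ^ m"
  shows "indep_nbr_count g (Suc m) t i s =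
    (if i' \<in> {0, t} then (if s then 0 else 2 ^ Suc m - 4) else 2 * indep_nbr_count g m t i' s + (if s then 0 else 4))"
proof -
  let ?S = "{0, t, i, xor i t}" and ?S' = "{0, t, i', xor i' t}"
  have tl: "t < 2 ^ Suc m" using t by simp
  have S: "?S \<subseteq> {..<2 ^ Suc m}" "card ?S = 4"
    using tl i t xor_less[OF i(1) tl] by auto
  have i': "i' < 2 ^ m" by (simp add: i'_def)
  have mm: "xor a b mod 2 ^ m = xor (a mod 2 ^ m) (b mod 2 ^ m)" for a b :: nat
    by (simp add: take_bit_xor flip: take_bit_eq_mod)
  have h: "edge_sign g (Suc m) t i k =
      (if i' \<in> {0, t} \<or> k mod 2 ^ m \<in> ?S' then -1 else edge_sign g m t i' (k mod 2 ^ m))"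
    if "k < 2 ^ Suc m" "k \<notin> ?S" for k
  proof -
    have x: "xor a b \<in> {0, t} \<longleftrightarrow> b \<in> {a, xor a t}" for a b
      by (metis insert_iff singleton_iff xor_eq_0 xor_self_left)
    have "xor i k \<notin> {0, t}" "k \<notin> {0, t}" using that x[of i k] by auto
    from edge_sign_low'[OF g t i(1) that(1) i(2) this(2,1)] x[of i' "k mod 2 ^ m"]
    show ?thesis by (auto simp: i'_def)
  qed
  show ?thesis
  proof (cases "i' \<in> {0, t}")
    case True
    have "{k. k < 2 ^ Suc m \<and> k \<notin> ?S \<and> edge_sign g (Suc m) t i k = sgn_of s} = (if s then {} else {..<2 ^ Suc m} - ?S)"
      using h True by auto
    then show ?thesis using True S by (simp add: indep_nbr_count_def card_Diff_subset del: power_Suc)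
  next
    case False
    have S': "?S' \<subseteq> {..<2 ^ m}" "card ?S' = 4"
      using t i' False xor_less[OF i' t(1)] by auto
    let ?A = "{k. k < 2 ^ Suc m \<and> (k mod 2 ^ m \<notin> ?S' \<and> edge_sign g m t i' (k mod 2 ^ m) = sgn_of s)}"
    let ?B = "{k. k < 2 ^ Suc m \<and> k mod 2 ^ m \<in> ?S'}"
    have tm: "t mod 2 ^ m = t" using t by simp
    have S_B: "k mod 2 ^ m \<in> ?S'" if "k \<in> ?S" for k
      using that tm by (auto simp: mm i'_def)
    have "{k. k < 2 ^ Suc m \<and> k \<notin> ?S \<and> edge_sign g (Suc m) t i k = sgn_of s} = ?A \<union> (if s then {} else ?B - ?S)"
    proof -
      have *: "{k. k < N \<and> k \<notin> S \<and> h k = sgn_of s} =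
          {k. k < N \<and> (f k \<notin> S' \<and> h' (f k) = sgn_of s)} \<union> (if s then {} else {k. k < N \<and> f k \<in> S'} - S)"
        if "\<And>k. k < N \<Longrightarrow> k \<notin> S \<Longrightarrow> h k = (if f k \<in> S' then -1 else h' (f k))"
          "\<And>k. k \<in> S \<Longrightarrow> f k \<in> S'" for N and f :: "nat \<Rightarrow> nat" and S S' :: "nat set" and h h'
      proof (intro set_eqI)
        fix x
        show "x \<in> {k. k < N \<and> k \<notin> S \<and> h k = sgn_of s} \<longleftrightarrow>
            x \<in> {k. k < N \<and> (f k \<notin> S' \<and> h' (f k) = sgn_of s)} \<union> (if s then {} else {k. k < N \<and> f k \<in> S'} - S)"
          using that(1)[of x] that(2)[of x] by (cases "x \<in> S"; cases "f x \<in> S'"; cases "x < N") simp_all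
      qed
      have h0: "edge_sign g (Suc m) t i k = (if k mod 2 ^ m \<in> ?S' then -1 else edge_sign g m t i' (k mod 2 ^ m))"
        if "k < 2 ^ Suc m" "k \<notin> ?S" for k
        unfolding h[OF that] using False by (simp only: if_False simp_thms)
      show ?thesis by (rule *[where f = "\<lambda>k. k mod 2 ^ m" and h' = "edge_sign g m t i'", OF h0 S_B])
    qed
    moreover have "card ?A = 2 * indep_nbr_count g m t i' s"
      unfolding indep_nbr_count_def by (rule card_mod)
    \<comment> \<open>The four residues in the span of \<open>i'\<close> and \<open>t\<close> have
      eight lifts, and four of these are the excluded vectors.\<close>
    moreover have "card (?B - ?S) = 4"
    proof -
      have "{k. k < 2 ^ m \<and> k \<in> ?S'} = ?S'" using S'(1) by auto
      then have "card ?B = 8" using card_mod[of m "\<lambda>k. k \<in> ?S'"] S'(2) by simp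
      moreover have "?S \<subseteq> ?B" using S(1) S_B by auto
      ultimately show ?thesis using S(2) by (simp add: card_Diff_subset)
    qed
    moreover have "?A \<inter> (if s then {} else ?B - ?S) = {}" by auto
    ultimately show ?thesis using False by (simp add: indep_nbr_count_def card_Un_disjoint)
  qed
qed

section \<open>The degree formula\<close>

lemma highE:
  assumes "\<not> t < 2 ^ m" "t < (2::nat) ^ Suc m"
  obtains t' where "t = 2 ^ m + t'" "t' < 2 ^ m"
  using assms by (metis less_Suc_pow_cases)

lemma level_pos:
  assumes "t < 2 ^ n" "i < 2 ^ n" "i \<noteq> 0 \<or> t \<noteq> 0"
  shows "1 \<le> level n t i"
  using assms
proof (induction n)
  case (Suc n)
  then show ?case by (cases "t = 0") auto
qed auto

lemma fold_less:
  assumes "t < 2 ^ m" "i < 2 ^ Suc m"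
  shows "(if i < 2 ^ m then i else xor i (2 ^ m + t)) < (2::nat) ^ m"
  using assms(2) by (cases rule: less_Suc_pow_cases) (use assms(1) in \<open>auto simp: xor_top xor_less\<close>)

lemma fold_eq_0:
  assumes "i \<noteq> (0::nat)" "i \<noteq> 2 ^ m + t"
  shows "(if i < 2 ^ m then i else xor i (2 ^ m + t)) \<noteq> 0"
  using assms by auto

lemma level_1:
  assumes "t < 2 ^ n" "i < 2 ^ n" "t \<noteq> 0"
  shows "level n t i = 1 \<longleftrightarrow> i = 0 \<or> i = t"
proof (cases n)
  case 0
  then show ?thesis using assms by simp
next
  case (Suc m)
  have "level n t i \<noteq> 1" if i: "i \<noteq> 0" "i \<noteq> t"
  proof (cases "t < 2 ^ m")
    case True
    then show ?thesis using level_pos[of t m "i mod 2 ^ m"] assms i Suc by simp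
  next
    case False
    then obtain t' where t': "t = 2 ^ m + t'" "t' < 2 ^ m"
      using False assms(1)[unfolded Suc] by (metis highE)
    have "1 \<le> level m t' (if i < 2 ^ m then i else xor i t)"
      using level_pos[OF t'(2) fold_less[OF t'(2) assms(2)[unfolded Suc]]] fold_eq_0[of i m t'] i
      unfolding t'(1) by blast
    then show ?thesis using i assms t' Suc by (auto split: if_splits)
  qed
  then show ?thesis using Suc assms(3) by auto
qed

lemma level_le:
  assumes "t < 2 ^ n" "i < 2 ^ n" "i \<noteq> 0 \<or> t \<noteq> 0"
  shows "level n t i \<le> n"
  using assms
proof (induction n arbitrary: t i)
  case (Suc m)
  show ?case
  proof (cases "t = 0 \<or> i = 0 \<or> i = t")
    case True
    then show ?thesis using Suc.IH[of 0 i] Suc.prems by (auto intro: le_SucI)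
  next
    case False
    show ?thesis
    proof (cases "t < 2 ^ m")
      case True
      then show ?thesis using False Suc.IH[of t "i mod 2 ^ m"] by simp
    next
      case F: False
      then obtain t' where t': "t = 2 ^ m + t'" "t' < 2 ^ m"
        using Suc.prems(1) by (metis highE)
      have "level m t' (if i < 2 ^ m then i else xor i t) \<le> m"
        using Suc.IH[OF t'(2) fold_less[OF t'(2) Suc.prems(2)]] fold_eq_0[of i m t'] False
        unfolding t'(1) by meson
      then show ?thesis using F False t' by (auto split: if_splits)
    qed
  qed
qed auto

text \<open>Each flag member is twice as large as its predecessor, since the recursion of
  \<open>level\<close> takes full preimages of the smaller flag under a two-to-one reduction and
  puts \<open>{0, t}\<close> in front of them.\<close>

lemma card_level:
  assumes "t < 2 ^ n" "1 \<le> a" "a \<le> n"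
  shows "card {i. i < 2 ^ n \<and> (i \<noteq> 0 \<and> level n t i = a)} = 2 ^ (a - 1)"
  using assms
proof (induction n arbitrary: t a)
  case (Suc m)
  consider "t = 0" | "t \<noteq> 0" "a = 1" | a' t' where "a = Suc a'" "1 \<le> a'" "t = 2 ^ m + t'" "t' < 2 ^ m"
    | "t \<noteq> 0" "t < 2 ^ m" "a = 2" | a' where "t \<noteq> 0" "t < 2 ^ m" "a = Suc a'" "2 \<le> a'"
  proof (cases "t = 0 \<or> a = 1")
    case False
    then have a: "a = Suc (a - 1)" "1 \<le> a - 1" using Suc.prems(2) by auto
    from Suc.prems(1) show ?thesis
    proof (cases rule: less_Suc_pow_cases)
      case low
      show ?thesis using that(4) that(5)[OF _ low a(1)] False low a by linarith
    next
      case (high t')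
      show ?thesis using that(3)[OF a high] .
    qed
  qed (use that in auto)
  then show ?case
  proof cases
    case 1
    show ?thesis
    proof (cases "a \<le> m")
      case True
      then show ?thesis unfolding card_two_halves using 1 Suc.IH[of 0 a] Suc.prems by (simp cong: conj_cong)
    next
      case False
      then have "a = Suc m" using Suc.prems by simp
      moreover have "{i. i < 2 ^ m \<and> i \<noteq> 0 \<and> level m 0 i = Suc m} = {}"
        using level_le[of 0 m] by fastforce
      moreover have "{i. i < 2 ^ m} = {..<(2::nat) ^ m}" by auto
      ultimately show ?thesis unfolding card_two_halves using 1 by (simp cong: conj_cong)
    qed
  next
    case 2
    have "{i. i < 2 ^ Suc m \<and> (i \<noteq> 0 \<and> level (Suc m) t i = a)} = {t}"
      using level_1[OF Suc.prems(1) _ 2(1)] 2 Suc.prems by (auto simp del: level.simps power_Suc)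
    then show ?thesis using 2 by simp
  next
    case 3
    have t0: "t \<noteq> 0" "\<not> t < 2 ^ m"
      unfolding 3(3) by (metis add_is_0 power_not_zero zero_neq_numeral, simp)
    have "{i. i < 2 ^ Suc m \<and> (i \<noteq> 0 \<and> level (Suc m) t i = a)} = {i. i < 2 ^ Suc m \<and>
      ((if i < 2 ^ m then i else xor i (2 ^ m + t')) \<noteq> 0 \<and> level m t' (if i < 2 ^ m then i else xor i (2 ^ m + t')) = a')}"
    proof (rule Collect_cong, rule conj_cong[OF refl])
      fix i
      show "i \<noteq> 0 \<and> level (Suc m) t i = a \<longleftrightarrow>
        (if i < 2 ^ m then i else xor i (2 ^ m + t')) \<noteq> 0 \<and> level m t' (if i < 2 ^ m then i else xor i (2 ^ m + t')) = a'"
        using t0 3 by (cases "i = t") auto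
    qed
    then show ?thesis
      using card_fold[OF 3(4), of "\<lambda>i. i \<noteq> 0 \<and> level m t' i = a'"] Suc.IH[OF 3(4) 3(2)] Suc.prems 3(1,2)
      by (cases a') simp_all
  next
    case 4
    have m: "1 \<le> m" using 4 by (cases m) auto
    \<comment> \<open>The preimage of \<open>{0, t}\<close> under dropping the top bit, without
      \<open>0\<close> and \<open>t\<close> themselves, which have level 1.\<close>
    have "{i. i < 2 ^ Suc m \<and> (i \<noteq> 0 \<and> level (Suc m) t i = a)} = {2 ^ m, 2 ^ m + t}" (is "?L = ?R")
    proof (intro equalityI subsetI)
      fix i assume "i \<in> ?L"
      then have i: "i < 2 ^ Suc m" "i \<noteq> 0" "i \<noteq> t" "level m t (i mod 2 ^ m) = 1" 
        using 4 by (auto split: if_splits)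
      then have "i mod 2 ^ m = 0 \<or> i mod 2 ^ m = t" using level_1[OF 4(2) _ 4(1), of "i mod 2 ^ m"] by simp
      with i(1) show "i \<in> ?R" by (cases rule: less_Suc_pow_cases) (use i in auto)
    next
      fix i assume i: "i \<in> ?R"
      then have "i mod 2 ^ m = 0 \<or> i mod 2 ^ m = t" using 4 by auto
      then have "level m t (i mod 2 ^ m) = 1" using level_1[OF 4(2) _ 4(1), of "i mod 2 ^ m"] by simp
      then show "i \<in> ?L" using i 4 by auto
    qed
    then show ?thesis using 4 by simp
  next
    case 5
    have nd: "level m t (i mod 2 ^ m) = a' \<Longrightarrow> i mod 2 ^ m \<noteq> 0 \<and> i \<noteq> t" for i
      using level_1[OF 5(2) _ 5(1), of "i mod 2 ^ m"] 5 by auto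
    have "{i. i < 2 ^ Suc m \<and> (i \<noteq> 0 \<and> level (Suc m) t i = a)} = {i. i < 2 ^ Suc m \<and>
      (i mod 2 ^ m \<noteq> 0 \<and> level m t (i mod 2 ^ m) = a')}"
    proof (rule Collect_cong, rule conj_cong[OF refl])
      fix i
      show "(i \<noteq> 0 \<and> level (Suc m) t i = a) \<longleftrightarrow> (i mod 2 ^ m \<noteq> 0 \<and> level m t (i mod 2 ^ m) = a')"
        using nd[of i] 5 by (cases "i = 0"; cases "i = t") auto
    qed
    then show ?thesis
      using card_mod[of m "\<lambda>i. i \<noteq> 0 \<and> level m t i = a'"] Suc.IH[OF 5(2)] Suc.prems 5(3,4)
      by (cases a') simp_all
  qed
qed auto

text \<open>Digit 0 is left out: the places from 1 to \<open>n - 1\<close> sum to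
  \<open>2 ^ n - 2\<close>, the number of \<open>k\<close> outside \<open>{0, i}\<close>.\<close>

definition dsum :: "nat \<Rightarrow> (nat \<Rightarrow> bool) \<Rightarrow> nat" where
  "dsum n \<beta> = (\<Sum>b \<in> {1..<n}. if \<beta> b then 2 ^ b else 0)"

lemma dsum_Suc:
  assumes "1 \<le> m"
  shows "dsum (Suc m) \<beta> = (if \<beta> 1 then 2 else 0) + 2 * dsum m (\<lambda>b. \<beta> (Suc b))"
proof -
  have "dsum (Suc m) \<beta> = (if \<beta> 1 then 2 else 0) + (\<Sum>b \<in> {Suc 1..<Suc m}. if \<beta> b then 2 ^ b else 0)"
    unfolding dsum_def by (subst sum.atLeast_Suc_lessThan) (use assms in auto)
  also have "(\<Sum>b \<in> {Suc 1..<Suc m}. if \<beta> b then 2 ^ b else 0) = (\<Sum>b \<in> {1..<m}. if \<beta> (Suc b) then (2::nat) ^ Suc b else 0)"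
    by (simp only: sum.shift_bounds_Suc_ivl)
  also have "\<dots> = 2 * dsum m (\<lambda>b. \<beta> (Suc b))"
    unfolding dsum_def sum_distrib_left by (intro sum.cong) auto
  finally show ?thesis .
qed

lemma dsum_const: "1 \<le> n \<Longrightarrow> dsum n (\<lambda>b. c) = (if c then 2 ^ n - 2 else 0)"
proof (induction n rule: dec_induct)
  case base
  then show ?case by (simp add: dsum_def)
next
  case (step n)
  have "(2::nat) \<le> 2 ^ n" using step by (cases n) auto
  then show ?case unfolding dsum_Suc[OF step(1)] step.IH by (cases c) simp_all
qed

lemma dsum_cong: "(\<And>b. 1 \<le> b \<Longrightarrow> b < n \<Longrightarrow> \<beta> b = \<beta>' b) \<Longrightarrow> dsum n \<beta> = dsum n \<beta>'"
  unfolding dsum_def by (intro sum.cong) auto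

lemma even_dsum: "even (dsum n \<beta>)"
  unfolding dsum_def by (intro dvd_sum) auto

lemma dsum_inj:
  assumes "dsum n \<beta> = dsum n \<beta>'" "1 \<le> b" "b < n"
  shows "\<beta> b = \<beta>' b"
  using assms
proof (induction n arbitrary: b \<beta> \<beta>')
  case (Suc m)
  then have m: "1 \<le> m" by simp
  have "\<beta> 1 = \<beta>' 1 \<and> dsum m (\<lambda>b. \<beta> (Suc b)) = dsum m (\<lambda>b. \<beta>' (Suc b))"
    using Suc.prems(1) even_dsum[of m "\<lambda>b. \<beta> (Suc b)"] even_dsum[of m "\<lambda>b. \<beta>' (Suc b)"]
    unfolding dsum_Suc[OF m] by (cases "\<beta> 1"; cases "\<beta>' 1") (simp_all, presburger+)
  then show ?case using Suc.IH[of "\<lambda>b. \<beta> (Suc b)" "\<lambda>b. \<beta>' (Suc b)" "b - 1"] Suc.prems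
    by (cases "b = 1") auto
qed auto

lemma level_sign_0: "level_sign n 0 j" 
  by (cases n) auto

lemma level_sign_1: "level_sign n t 1" "level_sign n t 0" 
  by (cases n, auto)+

lemma nbr_count_all:
  assumes "i < 2 ^ n" "i \<noteq> 0" "\<And>k. k < 2 ^ n \<Longrightarrow> k \<noteq> 0 \<Longrightarrow> edge_sign g n t i k = 1"
  shows "nbr_count g n t i s = (if s then 2 ^ n - 2 else 0)"
proof -
  have "{k. k < 2 ^ n \<and> k \<notin> {0, i} \<and> edge_sign g n t i k = sgn_of s} = (if s then {..<2 ^ n} - {0, i} else {})"
    using assms(3) by auto
  moreover have "{0, i} \<subseteq> {..<2 ^ n}" "card {0, i} = 2" using assms(1,2) by auto
  ultimately show ?thesis by (simp add: nbr_count_def card_Diff_subset)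
qed

text \<open>Let \<open>l\<close> be the level of \<open>i\<close>. For \<open>b < l\<close>, the
  \<open>k\<close> whose span with \<open>i\<close> first meets the flag in its \<open>b\<close>-th
  member are the \<open>2 ^ (b - 1)\<close> vectors of level \<open>b\<close> and their translates
  by \<open>i\<close>, which gives the place value \<open>2 ^ b\<close>. The remaining
  \<open>2 ^ n - 2 ^ l\<close> vectors share the sign at level \<open>l\<close> and fill all places
  from \<open>l\<close> on; hence the minimum. The induction verifies this along the
  doubling.\<close>

lemma nbr_count_formula:
  assumes "\<forall>b<n. g b \<in> {1, -1}" "t < 2 ^ n" "i < 2 ^ n" "i \<noteq> 0"
  shows "nbr_count g n t i s = dsum n (\<lambda>b. level_sign n t (min (level n t i) b) = s)"
  using assms
proof (induction n arbitrary: t i s)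
  case (Suc m)
  note g = Suc.prems(1)
  have g': "\<forall>b<m. g b \<in> {1, -1}" using g by auto
  consider "t = 0 \<or> i = t" | t' where "t = 2 ^ m + t'" "t' < 2 ^ m" "i \<noteq> t"
    | "t \<noteq> 0" "t < 2 ^ m" "i \<noteq> t"
    using Suc.prems(2) by (cases rule: less_Suc_pow_cases) auto
  then show ?case
  proof cases
    case 1
    have "edge_sign g (Suc m) t i k = 1" if "k < 2 ^ Suc m" for k
      using 1 edge_sign_t0[OF g Suc.prems(3) that] edge_sign_t[OF g Suc.prems(2) that] by auto
    then have "nbr_count g (Suc m) t i s = (if s then 2 ^ Suc m - 2 else 0)"
      using Suc.prems by (intro nbr_count_all)
    also have "\<dots> = dsum (Suc m) (\<lambda>b. s)" by (rule dsum_const[symmetric]) simp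
    also have "\<dots> = dsum (Suc m) (\<lambda>b. level_sign (Suc m) t (min (level (Suc m) t i) b) = s)"
      by (rule dsum_cong) (use 1 in auto)
    finally show ?thesis .
  next
    case 2
    define i' where "i' = (if i < 2 ^ m then i else xor i (2 ^ m + t'))"
    have i': "i' < 2 ^ m" "i' \<noteq> 0"
      using fold_less[OF 2(2) Suc.prems(3)] fold_eq_0[of i m t'] 2 Suc.prems(4) by (auto simp: i'_def)
    then have m: "1 \<le> m" by (cases m) auto
    have l: "level (Suc m) t i = Suc (level m t' i')" using 2 Suc.prems(4) by (simp add: i'_def)
    have l1: "1 \<le> level m t' i'" using level_pos[OF 2(2)] i' by blast
    \<comment> \<open>Doubling moves the inverted digits up by one place, and the two dependent
      neighbours supply the new digit 1.\<close>
    have "nbr_count g (Suc m) t i s = 2 * nbr_count g m t' i' (\<not> s) + (if s then 2 else 0)"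
      unfolding nbr_count_eq_indep[OF g Suc.prems(2) _ Suc.prems(3), of s, unfolded 2(1)] i'_def
      using nbr_count_eq_indep[OF g Suc.prems(2) _ Suc.prems(3), of s] indep_nbr_count_high[OF g 2(2) Suc.prems(3), of s] 2 Suc.prems(4) by simp
    also have "\<dots> = (if level_sign (Suc m) t 1 = s then 2 else 0) + 2 * dsum m (\<lambda>b. level_sign m t' (min (level m t' i') b) = (\<not> s))"
      using Suc.IH[OF g' 2(2) i'] level_sign_1 by simp
    also have "dsum m (\<lambda>b. level_sign m t' (min (level m t' i') b) = (\<not> s)) = dsum m (\<lambda>b. level_sign (Suc m) t (min (level (Suc m) t i) (Suc b)) = s)"
      unfolding l by (rule dsum_cong) (use 2 l1 in auto)
    finally show ?thesis unfolding dsum_Suc[OF m] l by simp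
  next
    case 3
    define i' where "i' = i mod 2 ^ m"
    have i': "i' < 2 ^ m" by (simp add: i'_def)
    have m: "1 \<le> m" using 3 by (cases m) auto
    have l: "level (Suc m) t i = Suc (level m t i')" using 3 Suc.prems(4) by (simp add: i'_def)
    have nbr_count: "nbr_count g (Suc m) t i s = indep_nbr_count g (Suc m) t i s + (if s then 2 else 0)"
      using nbr_count_eq_indep[OF g Suc.prems(2) 3(1) Suc.prems(3)] 3 Suc.prems(4) by simp
    note low = indep_nbr_count_low[OF g 3(2,1) Suc.prems(3), folded i'_def]
    \<comment> \<open>Digit 1 of the smaller count comes from dependent neighbours. Their lifts
      outside the excluded vectors have sign -1, so it reappears inverted at place 2, below a new
      digit 1.\<close>
    have v2: "level_sign (Suc m) t 2 = False" using 3 by simp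
    have v1: "level_sign (Suc m) t 1" by (rule level_sign_1)
    show ?thesis
    proof (cases "i' \<in> {0, t}")
      case True
      have "(4::nat) \<le> 2 ^ Suc m" using m by (cases m) auto
      have "level m t i' = 1" using level_1[OF 3(2) i' 3(1)] True by simp
      then have "dsum (Suc m) (\<lambda>b. level_sign (Suc m) t (min (level (Suc m) t i) b) = s)
        = (if s then 2 else 0) + 2 * dsum m (\<lambda>b. \<not> s)"
        unfolding dsum_Suc[OF m] l using v1 v2 by (simp add: numeral_2_eq_2 min_def cong: dsum_cong)
      then show ?thesis using nbr_count low True 3 Suc.prems(4) dsum_const[OF m, of "\<not> s"]
        by (simp del: level.simps level_sign.simps add: diff_mult_distrib2)
    next
      case False
      have l2: "2 \<le> level m t i'"
        using level_1[OF 3(2) i' 3(1)] level_pos[OF 3(2) i'] False 3(1) by fastforce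
      then have m2: "1 \<le> m - 1" "m = Suc (m - 1)" using level_le[OF 3(2) i'] 3(1) by auto
      have IH: "nbr_count g m t i' s = dsum m (\<lambda>b. level_sign m t (min (level m t i') b) = s)"
        using Suc.IH[OF g' 3(2) i'] False by auto
      have e: "nbr_count g m t i' s = indep_nbr_count g m t i' s + (if s then 2 else 0)"
        using nbr_count_eq_indep[OF g' 3(2,1) i'] False by auto
      let ?X = "dsum (m - 1) (\<lambda>b. level_sign m t (min (level m t i') (Suc b)) = s)"
      have "dsum m (\<lambda>b. level_sign m t (min (level m t i') b) = s) = (if s then 2 else 0) + 2 * ?X"
        using dsum_Suc[OF m2(1), of "\<lambda>b. level_sign m t (min (level m t i') b) = s"] m2(2) l2 level_sign_1[of m t]
        by (simp add: min_def)
      moreover have "dsum (m - 1) (\<lambda>b. level_sign (Suc m) t (min (Suc (level m t i')) (Suc (Suc b))) = s) = ?X"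
        by (rule dsum_cong) (use 3 l2 in auto)
      moreover have "dsum m (\<lambda>b. level_sign (Suc m) t (min (Suc (level m t i')) (Suc b)) = s) =
        (if s then 0 else 2) + 2 * dsum (m - 1) (\<lambda>b. level_sign (Suc m) t (min (Suc (level m t i')) (Suc (Suc b))) = s)"
        using dsum_Suc[OF m2(1), of "\<lambda>b. level_sign (Suc m) t (min (Suc (level m t i')) (Suc b)) = s"] m2(2) l2 v2
        by (simp add: min_def numeral_2_eq_2)
      ultimately show ?thesis
        using nbr_count low[of s] False 3 Suc.prems(4) IH e v1 unfolding dsum_Suc[OF m] l by (auto simp: min_def)
    qed
  qed
qed auto

section \<open>From lines to indices\<close>

lemma xor_left_cancel [simp]: "xor c a = xor c b \<longleftrightarrow> a = (b::nat)"
  by (metis xor_self_left)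

lemma e_neq_zero: "j < 2 ^ m \<Longrightarrow> cd_scale r (cd_e m j) = cd_zero m \<longleftrightarrow> r = 0"
proof (induction m arbitrary: j)
  case (Suc m)
  from Suc.prems show ?case
    by (cases rule: less_Suc_pow_cases) (use Suc.IH in auto)
qed auto

lemma scale_e_eq:
  "i < 2 ^ m \<Longrightarrow> j < 2 ^ m \<Longrightarrow> r \<noteq> 0 \<Longrightarrow> cd_scale r (cd_e m i) = cd_scale s (cd_e m j) \<Longrightarrow> i = j \<and> r = s"
proof (induction m arbitrary: i j)
  case (Suc m)
  have sym: "cd_zero m = cd_scale r x \<longleftrightarrow> cd_scale r x = cd_zero m" for r x by auto
  from Suc.prems(1) show ?case
  proof (cases rule: less_Suc_pow_cases)
    case low
    from Suc.prems(2) show ?thesis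
      by (cases rule: less_Suc_pow_cases) (use Suc.IH[of i j] Suc.prems(3,4) low e_neq_zero[OF low, of r] in auto)
  next
    case (high i')
    note hi = high
    from Suc.prems(2) show ?thesis
    proof (cases rule: less_Suc_pow_cases)
      case low
      then show ?thesis using Suc.prems(3,4) hi e_neq_zero[OF hi(2), of r] by auto
    next
      case (high j')
      then show ?thesis using Suc.prems(3,4) hi Suc.IH[of i' j'] by auto
    qed
  qed
qed auto

lemma add_eq_zero:
  "x \<in> cd_carrier m \<Longrightarrow> y \<in> cd_carrier m \<Longrightarrow> cd_add x y = cd_zero m \<Longrightarrow> x = cd_scale (-1) y"
proof (induction m arbitrary: x y)
  case (Suc m)
  then obtain a b c d where "x = Pr a b" "y = Pr c d" "a \<in> cd_carrier m" "b \<in> cd_carrier m"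
    "c \<in> cd_carrier m" "d \<in> cd_carrier m"
    by auto
  then show ?case using Suc.IH[of a c] Suc.IH[of b d] Suc.prems(3) by simp
qed auto

lemma add_e_eq_zero:
  assumes "i < 2 ^ m" "j < 2 ^ m" "r \<noteq> 0"
  shows "cd_add (cd_scale r (cd_e m i)) (cd_scale s (cd_e m j)) = cd_zero m \<longleftrightarrow> i = j \<and> r + s = 0"
proof
  assume "cd_add (cd_scale r (cd_e m i)) (cd_scale s (cd_e m j)) = cd_zero m"
  then have "cd_scale r (cd_e m i) = cd_scale (- 1 * s) (cd_e m j)"
    using add_eq_zero[OF carrier_scale[OF carrier_e] carrier_scale[OF carrier_e]] by simp
  from scale_e_eq[OF assms this] show "i = j \<and> r + s = 0" by simp
next
  assume "i = j \<and> r + s = 0"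
  then show "cd_add (cd_scale r (cd_e m i)) (cd_scale s (cd_e m j)) = cd_zero m"
    by (simp add: add_scale_scale scale_0 carrier_e)
qed

definition vtx :: "nat \<Rightarrow> nat \<Rightarrow> nat \<Rightarrow> bool \<Rightarrow> cd" where
  "vtx n i j s = Pr (cd_e n i) (cd_scale (sgn_of s) (cd_e n j))"

text \<open>\<open>(0, e_t)\<close> squares to \<open>g n\<close> times (conjugate of
  \<open>e_t\<close>) times \<open>e_t\<close>, in the first component.\<close>

definition square_pos :: "(nat \<Rightarrow> real) \<Rightarrow> nat \<Rightarrow> nat \<Rightarrow> bool" where
  "square_pos g n t \<longleftrightarrow> g n * conj_sign t * eps g n t t = 1"

lemma sgn_of_sq [simp]: "sgn_of s * sgn_of s = 1" "sgn_of s * (sgn_of s * z) = z" "sgn_of s \<noteq> 0"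
  by (auto simp: sgn_of_def)

lemma sgn_of_inj [simp]: "sgn_of s = sgn_of s' \<longleftrightarrow> s = s'"
  by (auto simp: sgn_of_def)

lemma vtx_carrier: "vtx n i j s \<in> cd_carrier (Suc n)"
  by (auto simp: vtx_def intro: carrier_closed)

lemma vtx_nonzero: "i < 2 ^ n \<Longrightarrow> vtx n i j s \<noteq> cd_zero (Suc n)"
  using e_neq_zero[of i n 1] by (simp add: vtx_def)

lemma signed_basis_eq: "cd_signed_basis n = {cd_scale (sgn_of s) (cd_e n j) | s j. j < 2 ^ n}"
proof -
  have "cd_scale (sgn_of s) x = (if s then x else cd_neg x)" for s x by (simp add: sgn_of_def cd_neg_def)
  then show ?thesis
    unfolding cd_signed_basis_def cd_basis_def by (auto split: if_splits) 
qed

lemma basis'_eq: "cd_basis' n = {cd_e n i | i. i < 2 ^ n \<and> i \<noteq> 0}"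
  unfolding cd_basis'_def cd_basis_def using scale_e_eq[of _ n 0 1 1]
  by (auto, metis neq0_conv)

lemma line_vtx_eq:
  assumes "i < 2 ^ n" "j < 2 ^ n" "i' < 2 ^ n" "j' < 2 ^ n" "cd_line (vtx n i j s) = cd_line (vtx n i' j' s')"
  shows "i = i' \<and> j = j' \<and> s = s'"
proof -
  have "vtx n i j s = cd_scale 1 (vtx n i j s)" by simp
  then have "vtx n i j s \<in> cd_line (vtx n i' j' s')" using assms(5) unfolding cd_line_def by (metis rangeI)
  then obtain r where "vtx n i j s = cd_scale r (vtx n i' j' s')" unfolding cd_line_def by auto
  then have "cd_scale 1 (cd_e n i) = cd_scale r (cd_e n i')"
    "cd_scale (sgn_of s) (cd_e n j) = cd_scale (r * sgn_of s') (cd_e n j')"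
    by (simp_all add: vtx_def)
  with scale_e_eq[of i n i' 1 r] scale_e_eq[of j n j' "sgn_of s" "r * sgn_of s'"] assms show ?thesis by auto
qed

lemma cd_line_eqD: "cd_line u = cd_line w \<Longrightarrow> \<exists>r. w = cd_scale r u"
proof -
  assume "cd_line u = cd_line w"
  moreover have "w \<in> cd_line w" unfolding cd_line_def by (rule range_eqI[of _ _ 1]) simp
  ultimately show ?thesis unfolding cd_line_def by auto
qed

lemma orth_scale:
  assumes "u \<in> cd_carrier m" "v \<in> cd_carrier m" "cd_orth g m u v"
  shows "cd_orth g m (cd_scale r u) (cd_scale s v)"
  using assms by (simp add: cd_orth_def mul_scale_left mul_scale_right carrier_scale)

text \<open>The generators in the definition of an edge range over all trees; this puts every
  generator of a given line into the carrier.\<close>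

lemma carrier_scaleD: "cd_scale r x \<in> cd_carrier m \<Longrightarrow> x \<in> cd_carrier m"
proof (induction m arbitrary: x)
  case 0 then show ?case by (cases x) auto
next
  case (Suc m) then show ?case by (cases x) auto
qed

lemma orth_line:
  assumes "u \<in> cd_carrier m" "v \<in> cd_carrier m"
  shows "(\<exists>u' v'. cd_line u = cd_line u' \<and> cd_line v = cd_line v' \<and> cd_orth g m u' v') \<longleftrightarrow> cd_orth g m u v"
proof
  assume "\<exists>u' v'. cd_line u = cd_line u' \<and> cd_line v = cd_line v' \<and> cd_orth g m u' v'"
  then obtain u' v' where *: "cd_line u = cd_line u'" "cd_line v = cd_line v'" "cd_orth g m u' v'" by blast
  obtain r r' where r: "u = cd_scale r u'" "v = cd_scale r' v'"
    using cd_line_eqD[OF *(1)[symmetric]] cd_line_eqD[OF *(2)[symmetric]] by blast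
  then show "cd_orth g m u v" using orth_scale[OF _ _ *(3)] carrier_scaleD assms by metis
qed blast

context
  fixes g :: "nat \<Rightarrow> real" and n :: nat
  assumes g: "\<forall>b<Suc n. g b \<in> {1, -1}"
begin

lemma g_lower: "\<forall>b<n. g b \<in> {1, -1}" using g by auto

lemma eps_neq_0: "i < 2 ^ n \<Longrightarrow> j < 2 ^ n \<Longrightarrow> eps g n i j \<noteq> 0"
  using eps_sq[OF g_lower, of i j] by auto

lemma conj_sign_neq_0 [simp]: "conj_sign j \<noteq> 0" by (simp add: conj_sign_def)

lemma sgn_of_qq:
  assumes "t < 2 ^ n"
  shows "sgn_of (square_pos g n t) = g n * conj_sign t * eps g n t t"
  using eps_pm[OF g_lower assms assms] g by (auto simp: square_pos_def sgn_of_def conj_sign_def)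

lemma mul_vtx:
  assumes "i < 2 ^ n" "j < 2 ^ n" "k < 2 ^ n" "l < 2 ^ n"
  shows "cd_mul g (Suc n) (vtx n i j s) (vtx n k l s') =
    Pr (cd_add (cd_scale (eps g n i k) (cd_e n (xor i k)))
          (cd_scale (g n * sgn_of s * sgn_of s' * conj_sign l * eps g n l j) (cd_e n (xor l j))))
       (cd_add (cd_scale (sgn_of s' * eps g n l i) (cd_e n (xor l i)))
          (cd_scale (sgn_of s * conj_sign k * eps g n j k) (cd_e n (xor j k))))"
  using assms
  by (simp add: vtx_def mul_e conj_scale conj_e mul_scale_left[of _ n] mul_scale_right[of _ n] carrier_closed mult_ac)

lemma mul_vtx_zero:
  assumes "i < 2 ^ n" "t < 2 ^ n" "k < 2 ^ n" "l < 2 ^ n" "k \<noteq> 0"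
  shows "cd_mul g (Suc n) (vtx n i (xor i t) s) (vtx n k l s') = cd_zero (Suc n) \<longleftrightarrow>
    l = xor k t \<and> sgn_of s * sgn_of s' = eps g n (xor k t) i * eps g n (xor i t) k \<and> edge_sign g n t i k = sgn_of (square_pos g n t)"
proof -
  have it: "xor i t < 2 ^ n" "xor k t < 2 ^ n" using xor_less assms by auto
  have x: "xor i k = xor l (xor i t) \<longleftrightarrow> l = xor k t" "xor l i = xor (xor i t) k \<longleftrightarrow> l = xor k t"
    by (metis xor.assoc xor.commute xor_self_left)+
  note sgn_of = eps_pm[OF g_lower]
  define a b p p' et where "a = eps g n i k" and "b = eps g n (xor k t) (xor i t)" and
    "p = eps g n (xor k t) i" and "p' = eps g n (xor i t) k" and "et = eps g n t t"
  define W where "W = sgn_of s * sgn_of s'"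
  have sgn: "a = 1 \<or> a = -1" "b = 1 \<or> b = -1" "p = 1 \<or> p = -1" "p' = 1 \<or> p' = -1" "et = 1 \<or> et = -1"
    unfolding a_def b_def p_def p'_def et_def using sgn_of it assms by auto
  have gn: "g n = 1 \<or> g n = -1" using g by auto
  have cspm: "conj_sign j = 1 \<or> conj_sign j = -1" for j by (auto simp: conj_sign_def)
  have W: "W = 1 \<or> W = -1" by (auto simp: W_def sgn_of_def)
  have 1: "sgn_of s' * p + sgn_of s * conj_sign k * p' = 0 \<longleftrightarrow> W = p * p'"
    using sgn(3,4) assms(5) by (auto simp: W_def sgn_of_def)
  have 2: "a + g n * W * conj_sign (xor k t) * b = 0 \<longleftrightarrow> W * conj_sign (xor k t) * a * b = - g n"
    using sgn(1,2) W gn cspm[of "xor k t"] by (elim disjE) simp_all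
  have "edge_sign g n t i k = - (conj_sign t * et * (p * p' * conj_sign (xor k t) * a * b))"
    using assms(5) by (simp add: edge_sign_def a_def b_def p_def p'_def et_def)
  then have 3: "edge_sign g n t i k = sgn_of (square_pos g n t) \<longleftrightarrow> p * p' * conj_sign (xor k t) * a * b = - g n"
    unfolding sgn_of_qq[OF assms(2)] et_def[symmetric]
    using sgn(5) cspm[of t] by (elim disjE) auto
  have "cd_mul g (Suc n) (vtx n i (xor i t) s) (vtx n k l s') = cd_zero (Suc n) \<longleftrightarrow>
    l = xor k t \<and> eps g n i k + g n * sgn_of s * sgn_of s' * conj_sign l * eps g n l (xor i t) = 0 \<and>
      sgn_of s' * eps g n l i + sgn_of s * conj_sign k * eps g n (xor i t) k = 0"
    unfolding mul_vtx[OF assms(1) it(1) assms(3,4)]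
    using assms it xor_less[of _ n] eps_neq_0 by (auto simp: add_e_eq_zero x)
  also have "\<dots> \<longleftrightarrow> l = xor k t \<and> a + g n * W * conj_sign (xor k t) * b = 0 \<and> sgn_of s' * p + sgn_of s * conj_sign k * p' = 0"
    by (auto simp: a_def b_def p_def p'_def W_def mult_ac)
  also have "\<dots> \<longleftrightarrow> l = xor k t \<and> W = p * p' \<and> p * p' * conj_sign (xor k t) * a * b = - g n"
    unfolding 1 2 by auto
  finally show ?thesis using 3 unfolding W_def p_def p'_def by metis
qed

lemma orth_vtx:
  assumes "i < 2 ^ n" "t < 2 ^ n" "k < 2 ^ n" "l < 2 ^ n" "i \<noteq> 0" "k \<noteq> 0"
  shows "cd_orth g (Suc n) (vtx n i (xor i t) s) (vtx n k l s') \<longleftrightarrow>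
    l = xor k t \<and> sgn_of s * sgn_of s' = eps g n (xor k t) i * eps g n (xor i t) k \<and> edge_sign g n t i k = sgn_of (square_pos g n t)"
proof -
  have it: "xor i t < 2 ^ n" using xor_less assms by auto
  have "cd_mul g (Suc n) (vtx n k (xor k t) s') (vtx n i (xor i t) s) = cd_zero (Suc n) \<longleftrightarrow>
      sgn_of s' * sgn_of s = eps g n (xor i t) k * eps g n (xor k t) i \<and> edge_sign g n t k i = sgn_of (square_pos g n t)"
    using mul_vtx_zero[of k t i "xor i t" s' s] it assms by simp
  then show ?thesis
    unfolding cd_orth_def mul_vtx_zero[OF assms(1-4,6)] edge_sign_sym[OF g_lower assms(2,1,3)]
    by (auto simp: mult.commute)
qed

lemma verts_eq: "fst (gamma_e g (Suc n)) = {cd_line (vtx n i j s) | i j s.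
    i < 2 ^ n \<and> i \<noteq> 0 \<and> j < 2 ^ n \<and> cd_zero_divisor g (Suc n) (vtx n i j s)}"
  unfolding gamma_e_def gamma_e_verts_def basis'_eq signed_basis_eq vtx_def by auto

lemma orth_zero_divisor:
  assumes "cd_orth g (Suc n) (vtx n i j s) (vtx n k l s')" "i < 2 ^ n" "k < 2 ^ n"
  shows "cd_zero_divisor g (Suc n) (vtx n i j s)"
  using assms vtx_carrier vtx_nonzero unfolding cd_zero_divisor_def cd_orth_def by blast

lemma edges_iff:
  "{K, L} \<in> snd (gamma_e g (Suc n)) \<longleftrightarrow> K \<in> fst (gamma_e g (Suc n)) \<and> L \<in> fst (gamma_e g (Suc n)) \<and> K \<noteq> L \<and>
    (\<exists>u v. K = cd_line u \<and> L = cd_line v \<and> cd_orth g (Suc n) u v)"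
proof -
  have sym: "cd_orth g (Suc n) u v \<longleftrightarrow> cd_orth g (Suc n) v u" for u v by (auto simp: cd_orth_def)
  let ?E = "\<lambda>K L. K \<in> gamma_e_verts g (Suc n) \<and> L \<in> gamma_e_verts g (Suc n) \<and> K \<noteq> L \<and>
    (\<exists>u v. K = cd_line u \<and> L = cd_line v \<and> cd_orth g (Suc n) u v)"
  have E: "?E K L \<longleftrightarrow> ?E L K" for K L using sym by blast
  have "{K, L} \<in> gamma_e_edges g (Suc n) \<longleftrightarrow> (\<exists>K' L'. {K, L} = {K', L'} \<and> ?E K' L')"
    unfolding gamma_e_edges_def by blast
  also have "\<dots> \<longleftrightarrow> ?E K L" using E unfolding doubleton_eq_iff by blast
  finally show ?thesis by (simp add: gamma_e_def)
qed

lemma edges_vtx: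
  assumes "i < 2 ^ n" "t < 2 ^ n" "i \<noteq> 0" "k < 2 ^ n" "l < 2 ^ n" "k \<noteq> 0"
  shows "{cd_line (vtx n i (xor i t) s), cd_line (vtx n k l s')} \<in> snd (gamma_e g (Suc n)) \<longleftrightarrow>
    k \<noteq> i \<and> l = xor k t \<and> sgn_of s * sgn_of s' = eps g n (xor k t) i * eps g n (xor i t) k \<and> edge_sign g n t i k = sgn_of (square_pos g n t)"
    (is "?E \<longleftrightarrow> ?R")
proof -
  have it: "xor i t < 2 ^ n" using xor_less assms by auto
  have o: "(\<exists>u v. cd_line (vtx n i (xor i t) s) = cd_line u \<and> cd_line (vtx n k l s') = cd_line v \<and> cd_orth g (Suc n) u v)
    \<longleftrightarrow> l = xor k t \<and> sgn_of s * sgn_of s' = eps g n (xor k t) i * eps g n (xor i t) k \<and> edge_sign g n t i k = sgn_of (square_pos g n t)"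
    using orth_line[OF vtx_carrier vtx_carrier] orth_vtx assms by simp
  show ?thesis
  proof
    assume ?E
    then have *: "cd_line (vtx n i (xor i t) s) \<noteq> cd_line (vtx n k l s')"
      "l = xor k t \<and> sgn_of s * sgn_of s' = eps g n (xor k t) i * eps g n (xor i t) k \<and> edge_sign g n t i k = sgn_of (square_pos g n t)"
      unfolding edges_iff o by auto
    \<comment> \<open>For \<open>k = i\<close> the sign condition forces \<open>s = s'\<close>. The
      second line is then the first one, possibly orthogonal to itself, and an edge needs distinct
      lines.\<close>
    have "k \<noteq> i"
    proof
      assume "k = i"
      then have "l = xor i t" "sgn_of s * sgn_of s' = 1" using * eps_sq[OF g_lower it assms(1)] by auto
      then have "s = s'" by (auto simp: sgn_of_def split: if_splits)
      then show False using *(1) \<open>k = i\<close> \<open>l = _\<close> by simp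
    qed
    then show ?R using * by simp
  next
    assume R: ?R
    then have orth: "cd_orth g (Suc n) (vtx n i (xor i t) s) (vtx n k l s')" using orth_vtx assms by simp
    then have orth': "cd_orth g (Suc n) (vtx n k l s') (vtx n i (xor i t) s)" by (auto simp: cd_orth_def)
    show ?E unfolding edges_iff o verts_eq
      using R assms it orth_zero_divisor[OF orth] orth_zero_divisor[OF orth'] line_vtx_eq[OF assms(1) it assms(4,5)]
      by blast
  qed
qed

end

section \<open>Vertex degrees as neighbour counts\<close>

definition deg_in :: "'a set \<times> 'a set set \<Rightarrow> 'a \<Rightarrow> nat" where
  "deg_in G x = card {y \<in> fst G. {x, y} \<in> snd G}"

lemma graph_iso_card_deg:
  assumes "graph_iso G H"
  shows "card {x \<in> fst G. deg_in G x = d} = card {x \<in> fst H. deg_in H x = d}"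
proof -
  obtain f where f: "bij_betw f (fst G) (fst H)"
    "\<And>x y. x \<in> fst G \<Longrightarrow> y \<in> fst G \<Longrightarrow> {x, y} \<in> snd G \<longleftrightarrow> {f x, f y} \<in> snd H"
    using assms unfolding graph_iso_def by blast
  have deg: "deg_in H (f x) = deg_in G x" if x: "x \<in> fst G" for x
  proof -
    have "bij_betw f {y \<in> fst G. {x, y} \<in> snd G} {y \<in> fst H. {f x, y} \<in> snd H}"
      using f(1) by (rule bij_betw_Collect) (simp add: f(2)[OF x])
    then show ?thesis unfolding deg_in_def by (simp add: bij_betw_same_card)
  qed
  have "bij_betw f {x \<in> fst G. deg_in G x = d} {x \<in> fst H. deg_in H x = d}"
    using f(1) by (rule bij_betw_Collect) (simp add: deg)
  then show ?thesis by (rule bij_betw_same_card)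
qed

context
  fixes g :: "nat \<Rightarrow> real" and n :: nat
  assumes g: "\<forall>b<Suc n. g b \<in> {1, -1}"
begin

text \<open>For each admissible \<open>k\<close>, exactly one of the two lines with indices
  \<open>k\<close> and \<open>xor k t\<close> is adjacent, so neighbours correspond to indices
  \<open>k\<close>.\<close>

lemma deg_in_vtx:
  assumes "i < 2 ^ n" "t < 2 ^ n" "i \<noteq> 0"
  shows "deg_in (gamma_e g (Suc n)) (cd_line (vtx n i (xor i t) s)) = nbr_count g n t i (square_pos g n t)"
proof -
  define sg where "sg k = (sgn_of s = eps g n (xor k t) i * eps g n (xor i t) k)" for k
  let ?A = "{k. k < 2 ^ n \<and> k \<notin> {0, i} \<and> edge_sign g n t i k = sgn_of (square_pos g n t)}"
  have xl: "xor k t < 2 ^ n" if "k < 2 ^ n" for k using xor_less[OF that assms(2)] .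
  note g' = g_lower[OF g]
  have sg: "sgn_of s * sgn_of s' = eps g n (xor k t) i * eps g n (xor i t) k \<longleftrightarrow> s' = sg k" if "k < 2 ^ n" for k s'
  proof -
    have "sgn_of s * sgn_of s' = a * b \<longleftrightarrow> s' = (sgn_of s = a * b)" if "a = 1 \<or> a = -1" "b = 1 \<or> b = -1" for a b
      using that by (auto simp: sgn_of_def)
    from this[OF eps_pm[OF g' xl[OF that] assms(1)] eps_pm[OF g' xl[OF assms(1)] that]]
    show ?thesis unfolding sg_def .
  qed
  have "{y \<in> fst (gamma_e g (Suc n)). {cd_line (vtx n i (xor i t) s), y} \<in> snd (gamma_e g (Suc n))}
    = (\<lambda>k. cd_line (vtx n k (xor k t) (sg k))) ` ?A" (is "?L = ?R")
  proof (intro equalityI subsetI)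
    fix y assume y: "y \<in> ?L"
    then obtain k l s' where k: "k < 2 ^ n" "k \<noteq> 0" "l < 2 ^ n" "y = cd_line (vtx n k l s')"
      unfolding verts_eq[OF g] by auto
    have "{cd_line (vtx n i (xor i t) s), cd_line (vtx n k l s')} \<in> snd (gamma_e g (Suc n))"
      using y k(4) by simp
    then have "k \<noteq> i" "l = xor k t" "s' = sg k" "edge_sign g n t i k = sgn_of (square_pos g n t)"
      unfolding edges_vtx[OF g assms k(1,3,2)] sg[OF k(1)] by simp_all
    then show "y \<in> ?R" using k by simp
  next
    fix y assume "y \<in> ?R"
    then obtain k where k: "k \<in> ?A" "y = cd_line (vtx n k (xor k t) (sg k))" by auto
    then have k': "k < 2 ^ n" "k \<noteq> 0" by simp_all
    have "{cd_line (vtx n i (xor i t) s), y} \<in> snd (gamma_e g (Suc n))"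
      unfolding k(2) edges_vtx[OF g assms k'(1) xl[OF k'(1)] k'(2)] sg[OF k'(1)] using k(1) by simp
    then show "y \<in> ?L" unfolding edges_iff[OF g] by blast
  qed
  moreover have "inj_on (\<lambda>k. cd_line (vtx n k (xor k t) (sg k))) ?A"
  proof (rule inj_onI)
    fix k k' assume "k \<in> ?A" "k' \<in> ?A" "cd_line (vtx n k (xor k t) (sg k)) = cd_line (vtx n k' (xor k' t) (sg k'))"
    then show "k = k'" using line_vtx_eq[of k n "xor k t" k' "xor k' t" "sg k" "sg k'"] xl by simp
  qed
  ultimately show ?thesis unfolding deg_in_def nbr_count_def by (simp add: card_image)
qed

text \<open>The factor 2 is the free sign in the second component. Since \<open>d\<close> is
  positive, each line counted on the right has a neighbour and is therefore a vertex.\<close>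

lemma count_deg:
  assumes "0 < d"
  shows "card {x \<in> fst (gamma_e g (Suc n)). deg_in (gamma_e g (Suc n)) x = d} =
    2 * (\<Sum>t<2 ^ n. card {i. i < 2 ^ n \<and> i \<noteq> 0 \<and> nbr_count g n t i (square_pos g n t) = d})"
proof -
  let ?I = "SIGMA t : {..<2 ^ n}. {i. i < 2 ^ n \<and> i \<noteq> 0 \<and> nbr_count g n t i (square_pos g n t) = d} \<times> (UNIV :: bool set)"
  let ?f = "\<lambda>(t, i, s). cd_line (vtx n i (xor i t) s)"
  note g' = g_lower[OF g]
  have xl: "xor k t < 2 ^ n" if "k < 2 ^ n" "t < 2 ^ n" for k t :: nat using that xor_less by blast
  have "{x \<in> fst (gamma_e g (Suc n)). deg_in (gamma_e g (Suc n)) x = d} = ?f ` ?I" (is "?L = ?R")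
  proof (intro equalityI subsetI)
    fix x assume x: "x \<in> ?L"
    then obtain i j s where i: "i < 2 ^ n" "i \<noteq> 0" "j < 2 ^ n" "x = cd_line (vtx n i j s)"
      unfolding verts_eq[OF g] by auto
    define t where "t = xor i j"
    have t: "t < 2 ^ n" "x = cd_line (vtx n i (xor i t) s)" using xl i by (auto simp: t_def)
    then have "nbr_count g n t i (square_pos g n t) = d" using x deg_in_vtx[OF i(1) t(1) i(2)] by auto
    then show "x \<in> ?R" using t i by (intro image_eqI[of _ _ "(t, i, s)"]) auto
  next
    fix x assume "x \<in> ?R"
    then obtain t i s where i: "t < 2 ^ n" "i < 2 ^ n" "i \<noteq> 0" "nbr_count g n t i (square_pos g n t) = d"
      "x = cd_line (vtx n i (xor i t) s)" by auto
    then have deg: "deg_in (gamma_e g (Suc n)) x = d" using deg_in_vtx by simp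
    then have "{y \<in> fst (gamma_e g (Suc n)). {x, y} \<in> snd (gamma_e g (Suc n))} \<noteq> {}"
      using assms unfolding deg_in_def by (metis card.empty less_irrefl)
    then have "x \<in> fst (gamma_e g (Suc n))" unfolding edges_iff[OF g] by blast
    then show "x \<in> ?L" using deg by simp
  qed
  moreover have "inj_on ?f ?I"
  proof (rule inj_onI)
    fix x y assume xy: "x \<in> ?I" "y \<in> ?I" "?f x = ?f y"
    obtain t i s t' i' s' where *: "x = (t, i, s)" "y = (t', i', s')" by (cases x, cases y) auto
    then have "t < 2 ^ n" "i < 2 ^ n" "t' < 2 ^ n" "i' < 2 ^ n" "i = i' \<and> xor i t = xor i' t' \<and> s = s'"
      using xy line_vtx_eq[of i n "xor i t" i' "xor i' t'" s s'] xl by auto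
    then have "i = i'" "s = s'" "xor i (xor i t) = xor i (xor i t')" by auto
    then show "x = y" unfolding * by simp
  qed
  moreover have "card ?I = (\<Sum>t<2 ^ n. card ({i. i < 2 ^ n \<and> i \<noteq> 0 \<and> nbr_count g n t i (square_pos g n t) = d} \<times> (UNIV :: bool set)))"
    by (rule card_SigmaI) auto
  ultimately show ?thesis
    by (simp only: card_image card_cartesian_product card_UNIV_bool sum_distrib_left mult.commute)
qed

end

section \<open>Recovering the parameters\<close>

text \<open>The norm form at \<open>e_t\<close>, that is \<open>e_t\<close> times its conjugate. On
  bit vectors it is a character: the product of \<open>- g b\<close> over the binary digits
  \<open>b\<close> set in \<open>t\<close>.\<close>

definition diag_sign :: "(nat \<Rightarrow> real) \<Rightarrow> nat \<Rightarrow> nat \<Rightarrow> real" where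
  "diag_sign g n t = conj_sign t * eps g n t t"

lemma diag_sign_low: "t < 2 ^ n \<Longrightarrow> diag_sign g (Suc n) t = diag_sign g n t"
  by (simp add: diag_sign_def)

lemma diag_sign_high: "t < 2 ^ n \<Longrightarrow> diag_sign g (Suc n) (2 ^ n + t) = - g n * diag_sign g n t"
  unfolding diag_sign_def eps_hh conj_sign_top by simp

lemma diag_sign_0: "diag_sign g n 0 = 1"
  using eps_0[of 0 n g] by (simp add: diag_sign_def)

lemma diag_sign_sq: "\<forall>b<n. g b \<in> {1, -1} \<Longrightarrow> t < 2 ^ n \<Longrightarrow> diag_sign g n t = 1 \<or> diag_sign g n t = -1"
  using eps_pm[of n g t t] by (auto simp: diag_sign_def conj_sign_def)

lemma diag_sign_mono: "m \<le> n \<Longrightarrow> t < 2 ^ m \<Longrightarrow> diag_sign g n t = diag_sign g m t"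
proof (induction n rule: dec_induct)
  case (step n)
  have "t < 2 ^ n" using step by (meson less_le_trans one_le_numeral power_increasing)
  then show ?case using diag_sign_low step by simp
qed simp

lemma diag_sign_add:
  assumes "k \<le> n" "2 ^ k * y + x < 2 ^ n" "x < 2 ^ k"
  shows "diag_sign g n (2 ^ k * y + x) = diag_sign g n (2 ^ k * y) * diag_sign g n x"
  using assms
proof (induction n arbitrary: y rule: dec_induct)
  case base
  then have "y = 0" by (cases y) auto
  then show ?case by (simp add: diag_sign_0)
next
  case (step n)
  have k: "(2::nat) ^ n = 2 ^ k * 2 ^ (n - k)" using step(1) by (simp flip: power_add)
  have x: "x < 2 ^ n" using step by (meson less_le_trans one_le_numeral power_increasing)
  from step.prems(1) show ?case
  proof (cases rule: less_Suc_pow_cases)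
    case low
    then show ?thesis using step.IH step.prems x by (simp add: diag_sign_low)
  next
    case (high t)
    have "2 ^ (n - k) \<le> y"
    proof (rule ccontr)
      assume "\<not> 2 ^ (n - k) \<le> y"
      then have "Suc y \<le> 2 ^ (n - k)" by simp
      then have "2 ^ k * Suc y \<le> 2 ^ n" unfolding k by (rule mult_le_mono2)
      then show False using high step.prems(2) by simp
    qed
    then obtain z where z: "y = 2 ^ (n - k) + z" using le_Suc_ex by blast
    have y: "2 ^ k * y = 2 ^ n + 2 ^ k * z" unfolding k z by (simp add: distrib_left)
    have t: "t = 2 ^ k * z + x" using high(1) unfolding y by simp
    then show ?thesis using step.IH[of z] high(2) step.prems(2) x
      unfolding y by (simp add: diag_sign_high diag_sign_low add.assoc)
  qed
qed

lemma diag_sign_pow: "b < n \<Longrightarrow> diag_sign g n (2 ^ b) = - g b"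
  using diag_sign_mono[of "Suc b" n "2 ^ b" g] diag_sign_high[of 0 b g] by (simp add: diag_sign_0)

lemma square_pos_chi: "square_pos g n t \<longleftrightarrow> g n * diag_sign g n t = 1"
  by (simp add: square_pos_def diag_sign_def mult.assoc)

lemma diag_sign_small:
  assumes "3 \<le> n"
  shows "diag_sign g n 1 = - g 0" "diag_sign g n 2 = - g 1" "diag_sign g n 3 = g 0 * g 1" "diag_sign g n 4 = - g 2"
    "diag_sign g n 5 = g 0 * g 2" "diag_sign g n 6 = g 1 * g 2" "diag_sign g n 7 = - g 0 * g 1 * g 2"
proof -
  have l: "(8::nat) \<le> 2 ^ n" using power_increasing[OF assms, of "2::nat"] by simp
  show 1: "diag_sign g n 1 = - g 0" using diag_sign_pow[of 0 n g] assms by simp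
  show 2: "diag_sign g n 2 = - g 1" using diag_sign_pow[of 1 n g] assms by simp
  show 4: "diag_sign g n 4 = - g 2" using diag_sign_pow[of 2 n g] assms by simp
  show 3: "diag_sign g n 3 = g 0 * g 1" using diag_sign_add[of 1 n 1 1 g] assms l 1 2 by simp
  show "diag_sign g n 5 = g 0 * g 2" using diag_sign_add[of 2 n 1 1 g] assms l 1 4 by simp
  show "diag_sign g n 6 = g 1 * g 2" using diag_sign_add[of 2 n 1 2 g] assms l 2 4 by simp
  show "diag_sign g n 7 = - g 0 * g 1 * g 2" using diag_sign_add[of 2 n 1 3 g] assms l 3 4 by simp
qed

definition definite :: "(nat \<Rightarrow> real) \<Rightarrow> bool" where
  "definite g \<longleftrightarrow> g 0 = -1 \<and> g 1 = -1 \<and> g 2 = -1"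

text \<open>The character is trivial on the eight vectors exactly in the definite case; otherwise it
  takes each value four times, and one of the values 1 belongs to \<open>x = 0\<close>. The outcomes
  7, 0, 3, 4 are distinct, so the count reveals both \<open>K\<close> and definiteness.\<close>

lemma card_diag_sign_low:
  assumes "3 \<le> n" "\<forall>b<n. g b \<in> {1, -1}" "K = 1 \<or> K = -1"
  shows "card {x \<in> {1..7}. K * diag_sign g n x = 1} =
    (if definite g then if K = 1 then 7 else 0 else if K = 1 then 3 else 4)"
proof -
  have "{1..7} = {1, 2, 3, 4, 5, 6, 7::nat}" by auto
  then have "card {x \<in> {1..7}. K * diag_sign g n x = 1} = (\<Sum>x \<in> {1, 2, 3, 4, 5, 6, 7}. of_bool (K * diag_sign g n x = 1))"
    by (simp flip: sum.inter_filter card_eq_sum add: of_bool_def)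
  also have "\<dots> = (if definite g then if K = 1 then 7 else 0 else if K = 1 then 3 else 4)"
  proof -
    have "g 0 = 1 \<or> g 0 = -1" "g 1 = 1 \<or> g 1 = -1" "g 2 = 1 \<or> g 2 = -1" using assms by auto
    moreover have sum: "sum f {1, 2, 3, 4, 5, 6, 7} = f 1 + f 2 + f 3 + f 4 + f 5 + f 6 + f 7" for f :: "nat \<Rightarrow> nat"
      by simp
    ultimately show ?thesis using assms(3)
      unfolding sum diag_sign_small[OF assms(1)] definite_def by (elim disjE) simp_all
  qed
  finally show ?thesis .
qed

section \<open>Sign patterns along the flag and the bits of \<open>t\<close> from place 3 on\<close>

lemma level_sign_2: "t < 2 ^ n \<Longrightarrow> t \<noteq> 0 \<Longrightarrow> \<not> level_sign n t 2"
  by (cases n) (auto simp: level_sign_1[simplified])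

lemma eight_pow: "3 \<le> n \<Longrightarrow> (2::nat) ^ n = 8 * 2 ^ (n - 3)"
  using power_add[of "2::nat" 3 "n - 3"] by simp

lemma pow_step: "3 \<le> n \<Longrightarrow> 2 ^ (Suc n - 3) = 2 * (2::nat) ^ (n - 3)"
  by (simp only: Suc_diff_le power_Suc)

lemma eight_less: "3 \<le> n \<Longrightarrow> x < 8 \<Longrightarrow> 8 * y + x < 2 ^ n \<longleftrightarrow> y < (2::nat) ^ (n - 3)"
  unfolding eight_pow by auto

text \<open>In dimension eight all nonzero \<open>x\<close> share one pattern, and every further
  doubling looks only at whether the index is zero and at its top bit, which is a bit of
  \<open>y\<close>.\<close>

lemma level_sign_small:
  assumes "3 \<le> n" "y < 2 ^ (n - 3)" "x \<in> {1..7}" "x' \<in> {1..7}" "b < n"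
  shows "level_sign n (8 * y + x) b = level_sign n (8 * y + x') b"
  using assms(1,2,5)
proof (induction n arbitrary: y b rule: dec_induct)
  case base
  then have "level_sign 3 (8 * y + x) b = (b \<noteq> 2)" if "x \<in> {1..7}" for x
  proof (cases "b = 2")
    case True
    then show ?thesis using level_sign_2[of x 3] that base by auto
  next
    case False
    then have "b = 0 \<or> b = 1" using base by auto
    then show ?thesis using level_sign_1 False by auto
  qed
  then show ?case using assms(3,4) by simp
next
  case (step n)
  have p: "(2::nat) ^ n = 8 * 2 ^ (n - 3)" using eight_pow step by simp
  have lt: "8 * y + x < 2 ^ n \<longleftrightarrow> y < 2 ^ (n - 3)" if "x \<in> {1..7}" for x
    using eight_less[of n x y] that step by simp
  show ?case
  proof (cases "y < 2 ^ (n - 3)")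
    case True
    then show ?thesis using lt step assms(3,4) by simp
  next
    case False
    have "2 ^ (Suc n - 3) = 2 * (2::nat) ^ (n - 3)" using pow_step[of n] step(1) by linarith
    then have "y - 2 ^ (n - 3) < 2 ^ (n - 3)" using step False by simp
    moreover have "8 * y + x - 2 ^ n = 8 * (y - 2 ^ (n - 3)) + x" for x using False p by simp
    ultimately show ?thesis using lt step False assms(3,4) by simp
  qed
qed

text \<open>As \<open>y\<close> is odd, bit 3 is set, so the step to dimension sixteen inverts the
  pattern of \<open>x\<close>; its last two digits become False, True. Later doublings move these
  two up, possibly inverting both.\<close>

lemma level_sign_alternates:
  assumes "4 \<le> n" "y < 2 ^ (n - 3)" "odd y" "x \<in> {1..7}"
  shows "level_sign n (8 * y + x) (n - 2) \<noteq> level_sign n (8 * y + x) (n - 1)"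
  using assms(1-3)
proof (induction n arbitrary: y rule: dec_induct)
  case base
  then have "y = 1" by (cases y) auto
  moreover have "level_sign 3 x 1" "\<not> level_sign 3 x 2" using level_sign_1 level_sign_2[of x 3] assms(4) by auto
  ultimately show ?case using assms(4) by (simp add: eval_nat_numeral)
next
  case (step n)
  have p: "(2::nat) ^ n = 8 * 2 ^ (n - 3)" using eight_pow step by simp
  have lt: "8 * y + x < 2 ^ n \<longleftrightarrow> y < 2 ^ (n - 3)"
    using eight_less[of n x y] step assms(4) by simp
  have n: "\<not> n \<le> 1" "\<not> n - 1 \<le> 1" "n \<noteq> 2" "n - 1 \<noteq> 2" "Suc n - 2 = n - 1" "Suc n - 1 = n" "n - 1 - 1 = n - 2" using step(1) by auto
  have nz: "8 * y + x \<noteq> 0" using assms(4) by auto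
  show ?case
  proof (cases "y < 2 ^ (n - 3)")
    case True
    then show ?thesis using lt step nz by (simp add: n[simplified] n level_sign_0)
  next
    case False
    have "2 ^ (Suc n - 3) = 2 * (2::nat) ^ (n - 3)" using pow_step[of n] step(1) by linarith
    then have "y - 2 ^ (n - 3) < 2 ^ (n - 3)" using step False by simp
    moreover have "8 * y + x - 2 ^ n = 8 * (y - 2 ^ (n - 3)) + x" for x using False p by simp
    moreover have "odd (y - 2 ^ (n - 3))" using step False by auto
    ultimately show ?thesis using lt step.IH[of "y - 2 ^ (n - 3)"] nz False by (simp add: n[simplified] n level_sign_0)
  qed
qed

text \<open>For nonzero \<open>t\<close>, digit 3 is True exactly if the top bit is set and the
  remaining bits are not all zero. Undoing one doubling exposes the next bit, until only
  \<open>t mod 8\<close> is left.\<close>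

lemma level_sign_determines:
  assumes "4 \<le> n" "y < 2 ^ (n - 3)" "odd y" "x \<in> {1..7}" "t < 2 ^ n"
    and "\<And>b. 1 \<le> b \<Longrightarrow> b < n \<Longrightarrow> level_sign n t b = level_sign n (8 * y + x) b"
  shows "t div 8 = y \<and> t mod 8 \<noteq> 0"
  using assms(1-3,5-)
proof (induction n arbitrary: y t rule: dec_induct)
  case base
  then have y: "y = 1" by (cases y) auto
  have "level_sign 3 x 2 = False" using level_sign_2[of x 3] assms(4) by auto
  then have "level_sign 4 (8 * y + x) 3" using assms(4) y by (simp add: eval_nat_numeral)
  then have 3: "level_sign 4 t 3" using base(4)[of 3] by simp
  have "level_sign 4 (8 * y + x) 2 = False" using level_sign_2[of "8 * y + x" 4] y assms(4) by auto
  then have "\<not> level_sign 4 t 2" using base(4)[of 2] by simp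
  then have t: "t \<noteq> 0" using level_sign_0 by metis
  show ?case
  proof (cases "t < 8")
    case True
    have v: "level_sign 4 t 3 = level_sign 3 t 2" using True t by (simp add: eval_nat_numeral)
    have "\<not> level_sign 3 t 2" using True t by (intro level_sign_2) auto
    then show ?thesis using v 3 by simp
  next
    case False
    then obtain z where z: "t = 8 + z" "z < 8" using base(3) le_Suc_ex[of 8 t] by auto
    have v: "level_sign 4 t 3 = (\<not> level_sign 3 z 2)" using z by (simp add: eval_nat_numeral)
    have "z \<noteq> 0" using v 3 level_sign_0 by metis
    then show ?thesis using z y by auto
  qed
next
  case (step n)
  have p: "(2::nat) ^ n = 8 * 2 ^ (n - 3)" using eight_pow step by simp
  have lt: "8 * y + x < 2 ^ n \<longleftrightarrow> y < 2 ^ (n - 3)"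
    using eight_less[of n x y] step assms(4) by simp
  let ?u = "8 * y + x"
  have u: "?u \<noteq> 0" "?u < 2 ^ Suc n" using assms(4) eight_less[of "Suc n" x y] step by auto
  have "\<not> level_sign (Suc n) ?u 2" using level_sign_2[OF u(2,1)] .
  then have "\<not> level_sign (Suc n) t 2" using step.prems(4)[of 2] step(1) by simp
  then have t: "t \<noteq> 0" using level_sign_0 by metis
  have alt: "level_sign (Suc n) ?u (n - 1) \<noteq> level_sign (Suc n) ?u n"
    using level_sign_alternates[of "Suc n" y x] step assms(4) by simp
  have lowv: "level_sign (Suc n) w (Suc b) = level_sign n w b" if "w \<noteq> 0" "w < 2 ^ n" "2 \<le> b" for w b
    using that by simp
  have highv: "level_sign (Suc n) (2 ^ n + w) (Suc b) = (\<not> level_sign n w b)" if "w < 2 ^ n" "1 \<le> b" for w b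
    using that by simp
  have e3: "Suc 2 = 3" by simp
  show ?case
  proof (cases "y < 2 ^ (n - 3)")
    case True
    then have ul: "?u < 2 ^ n" using lt by simp
    \<comment> \<open>Digit 3 misses the top bit only for \<open>t = 2 ^ n\<close>. All digits of
      this index from place 2 on are False, whereas those of \<open>?u\<close> differ at the last
      two places.\<close>
    have tl: "t < 2 ^ n"
    proof (rule ccontr)
      assume "\<not> t < 2 ^ n"
      then obtain t' where t': "t = 2 ^ n + t'" "t' < 2 ^ n" using step.prems(3) by (metis highE)
      have "level_sign (Suc n) t 3 = level_sign (Suc n) ?u 3" using step.prems(4)[of 3] step(1) by simp
      then have "\<not> level_sign n t' 2 = level_sign n ?u 2" using highv[OF t'(2), of 2, unfolded e3] lowv[OF u(1) ul, of 2, unfolded e3] t'(1) by (auto simp del: level_sign.simps)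
      then have "level_sign n t' 2" using level_sign_2[OF ul u(1)] by simp
      then have "t' = 0" using level_sign_2[OF t'(2)] by auto
      then have "\<not> level_sign (Suc n) t (Suc b)" if "1 \<le> b" for b using highv[OF t'(2) that] t' level_sign_0 by (simp del: level_sign.simps)
      from this[of "n - 1"] this[of "n - 2"] have "\<not> level_sign (Suc n) t n" "\<not> level_sign (Suc n) t (n - 1)"
        using step(1) by (simp_all add: Suc_diff_Suc numeral_2_eq_2 del: level_sign.simps)
      moreover have "1 \<le> n" "n < Suc n" "1 \<le> n - 1" "n - 1 < Suc n" using step(1) by auto
      ultimately show False using alt step.prems(4)[of n] step.prems(4)[of "n - 1"] by blast
    qed
    have "level_sign n t b = level_sign n ?u b" if "1 \<le> b" "b < n" for b
    proof (cases "b = 1")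
      case True
      then show ?thesis using level_sign_1 by simp
    next
      case False
      then show ?thesis using lowv[OF t tl, of b] lowv[OF u(1) ul, of b] step.prems(4)[of "Suc b"] that by (simp del: level_sign.simps)
    qed
    then show ?thesis using step.IH[OF True step.prems(2) tl] by simp
  next
    case False
    define z where "z = y - 2 ^ (n - 3)"
    have "2 ^ (Suc n - 3) = 2 * (2::nat) ^ (n - 3)" using pow_step[of n] step(1) by linarith
    then have z: "z < 2 ^ (n - 3)" "y = 2 ^ (n - 3) + z" "odd z" using step False by (auto simp: z_def)
    have uz: "?u = 2 ^ n + (8 * z + x)" using z p by simp
    have zl: "8 * z + x < 2 ^ n" "8 * z + x \<noteq> 0" using eight_less[of n x z] z step(1) assms(4) by auto
    have "\<not> t < 2 ^ n"
    proof
      assume tl: "t < 2 ^ n"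
      have "level_sign (Suc n) t 3 = level_sign (Suc n) ?u 3" using step.prems(4)[of 3] step(1) by simp
      then have "level_sign n t 2 = (\<not> level_sign n (8 * z + x) 2)" using highv[OF zl(1), of 2, unfolded e3] lowv[OF t tl, of 2, unfolded e3] uz by (auto simp del: level_sign.simps)
      then show False using level_sign_2[OF tl t] level_sign_2[OF zl] by simp
    qed
    then obtain t' where t': "t = 2 ^ n + t'" "t' < 2 ^ n" using step.prems(3) by (metis highE)
    have "level_sign n t' b = level_sign n (8 * z + x) b" if "1 \<le> b" "b < n" for b
      using highv[OF t'(2) that(1)] highv[OF zl(1) that(1)] step.prems(4)[of "Suc b"] that t'(1) uz by (simp del: level_sign.simps)
    then have "t' div 8 = z \<and> t' mod 8 \<noteq> 0" using step.IH[OF z(1,3) t'(2)] by simp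
    then show ?thesis unfolding t'(1) z(2) p by simp
  qed
qed

text \<open>For odd \<open>y\<close> the two leading binary digits of this degree differ, so it is attained at the levels
  \<open>n - 1\<close> and \<open>n\<close> only.\<close>

lemma card_deg_pattern:
  assumes g: "\<forall>b<n. g b \<in> {1, -1}" and n: "4 \<le> n" and y: "y < 2 ^ (n - 3)" "odd y" and t: "t < 2 ^ n"
  shows "card {i. i < 2 ^ n \<and> i \<noteq> 0 \<and> nbr_count g n t i s = dsum n (level_sign n (8 * y + 1))} =
    (if s \<and> t div 8 = y \<and> t mod 8 \<noteq> 0 then 3 * 2 ^ (n - 2) else 0)"
proof -
  let ?u = "8 * y + 1"
  have alt: "level_sign n ?u (n - 2) \<noteq> level_sign n ?u (n - 1)"
    using level_sign_alternates[OF n y, of 1] by simp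
  have iff: "nbr_count g n t i s = dsum n (level_sign n ?u) \<longleftrightarrow>
    (n - 1 \<le> level n t i \<and> (s \<and> t div 8 = y \<and> t mod 8 \<noteq> 0))" if i: "i < 2 ^ n" "i \<noteq> 0" for i
  proof
    assume "nbr_count g n t i s = dsum n (level_sign n ?u)"
    then have "dsum n (\<lambda>b. level_sign n t (min (level n t i) b) = s) = dsum n (level_sign n ?u)"
      using nbr_count_formula[OF g t i] by simp
    from dsum_inj[OF this] have *: "(level_sign n t (min (level n t i) b) = s) = level_sign n ?u b" if "1 \<le> b" "b < n" for b
      using that by blast
    have l: "n - 1 \<le> level n t i"
    proof (rule ccontr)
      assume "\<not> n - 1 \<le> level n t i"
      then have "min (level n t i) (n - 1) = min (level n t i) (n - 2)" by simp
      then show False using *[of "n - 1"] *[of "n - 2"] alt n by simp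
    qed
    have **: "(level_sign n t b = s) = level_sign n ?u b" if "1 \<le> b" "b < n" for b
    proof -
      have "min (level n t i) b = b" using that l by simp
      then show ?thesis using *[OF that] by simp
    qed
    \<comment> \<open>Digit 1 is True in every pattern, so a match rules out that the degree spells
      the complement.\<close>
    have s: s using **[of 1] level_sign_1(1)[of n t] level_sign_1(1)[of n ?u] n by simp
    then have "t div 8 = y \<and> t mod 8 \<noteq> 0"
      using level_sign_determines[OF n y, of 1 t] t ** by simp
    then show "n - 1 \<le> level n t i \<and> (s \<and> t div 8 = y \<and> t mod 8 \<noteq> 0)" using l s by simp
  next
    assume R: "n - 1 \<le> level n t i \<and> (s \<and> t div 8 = y \<and> t mod 8 \<noteq> 0)"
    have "t mod 8 < 8" by simp
    then have tm: "t mod 8 \<in> {1..7}" "t = 8 * y + t mod 8" using R by auto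
    have "nbr_count g n t i s = dsum n (\<lambda>b. level_sign n t (min (level n t i) b) = s)"
      by (rule nbr_count_formula[OF g t i])
    also have "\<dots> = dsum n (level_sign n ?u)"
    proof (rule dsum_cong)
      fix b assume b: "1 \<le> b" "b < n"
      then have "min (level n t i) b = b" using R by auto
      then show "(level_sign n t (min (level n t i) b) = s) = level_sign n ?u b"
        using level_sign_small[of n y "t mod 8" 1 b] n y(1) tm b R by simp
    qed
    finally show "nbr_count g n t i s = dsum n (level_sign n ?u)" .
  qed
  show ?thesis
  proof (cases "s \<and> t div 8 = y \<and> t mod 8 \<noteq> 0")
    case True
    then have "t \<noteq> 0" by auto
    have "{i. i < 2 ^ n \<and> i \<noteq> 0 \<and> nbr_count g n t i s = dsum n (level_sign n ?u)} =
      {i. i < 2 ^ n \<and> (i \<noteq> 0 \<and> level n t i = n)} \<union> {i. i < 2 ^ n \<and> (i \<noteq> 0 \<and> level n t i = n - 1)}"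
      using iff True level_le[OF t] by (auto simp: le_antisym)
    also have "card \<dots> = 2 ^ (n - 1) + 2 ^ (n - 2)"
      using card_level[OF t, of n] card_level[OF t, of "n - 1"] n
      by (subst card_Un_disjoint) (auto simp: diff_diff_eq)
    also have "\<dots> = 3 * 2 ^ (n - 2)"
      using n power_Suc[of "2::nat" "n - 2"] by (simp add: Suc_diff_Suc numeral_2_eq_2)
    finally show ?thesis using True by simp
  next
    case False
    then have "{i. i < 2 ^ n \<and> i \<noteq> 0 \<and> nbr_count g n t i s = dsum n (level_sign n ?u)} = {}"
      using iff by blast
    then show ?thesis using False by auto
  qed
qed

text \<open>Only the seven indices \<open>8 * y + x\<close> contribute, equally many vertices each,
  provided \<open>square_pos\<close> holds; multiplicativity of the norm form splits this sign into
  a part from \<open>8 * y\<close> and one from \<open>x\<close>.\<close>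

lemma sum_deg_pattern:
  assumes g: "\<forall>b<Suc n. g b \<in> {1, -1}" and n: "4 \<le> n" and y: "y < 2 ^ (n - 3)" "odd y"
  shows "(\<Sum>t<2 ^ n. card {i. i < 2 ^ n \<and> i \<noteq> 0 \<and> nbr_count g n t i (square_pos g n t) = dsum n (level_sign n (8 * y + 1))}) =
    3 * 2 ^ (n - 2) * card {x \<in> {1..7}. (g n * diag_sign g n (8 * y)) * diag_sign g n x = 1}"
proof -
  have g': "\<forall>b<n. g b \<in> {1, -1}" using g by auto
  have "(\<Sum>t<2 ^ n. card {i. i < 2 ^ n \<and> i \<noteq> 0 \<and> nbr_count g n t i (square_pos g n t) = dsum n (level_sign n (8 * y + 1))}) =
    (\<Sum>t \<in> {..<2 ^ n}. if t \<in> {t. square_pos g n t \<and> t div 8 = y \<and> t mod 8 \<noteq> 0} then 3 * 2 ^ (n - 2) else 0)"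
    using card_deg_pattern[OF g' n y] by (intro sum.cong) auto
  also have "\<dots> = 3 * 2 ^ (n - 2) * card ({..<2 ^ n} \<inter> {t. square_pos g n t \<and> t div 8 = y \<and> t mod 8 \<noteq> 0})"
    by (subst sum.inter_restrict[symmetric]) auto
  also have "{..<2 ^ n} \<inter> {t. square_pos g n t \<and> t div 8 = y \<and> t mod 8 \<noteq> 0} =
      (+) (8 * y) ` {x \<in> {1..7}. (g n * diag_sign g n (8 * y)) * diag_sign g n x = 1}" (is "?A = ?B")
  proof -
    have q: "square_pos g n (8 * y + x) \<longleftrightarrow> (g n * diag_sign g n (8 * y)) * diag_sign g n x = 1" if "x < 8" for x
      using diag_sign_add[of 3 n y x g] eight_less[of n x y] that n y(1) by (simp add: square_pos_chi mult.assoc)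
    show ?thesis
    proof (intro equalityI subsetI)
      fix t assume t: "t \<in> ?A"
      have "t mod 8 < 8" by simp
      then have tm: "t mod 8 \<in> {1..7}" "t = 8 * y + t mod 8" using t by auto
      then show "t \<in> ?B" using t q[of "t mod 8"] by auto
    next
      fix t assume "t \<in> ?B"
      then obtain x where x: "t = 8 * y + x" "x \<in> {1..7}" "(g n * diag_sign g n (8 * y)) * diag_sign g n x = 1" by auto
      then show "t \<in> ?A" using q[of x] eight_less[of n x y] n y(1) by auto
    qed
  qed
  finally show ?thesis by (simp add: card_image)
qed

text \<open>This is the largest possible degree. For \<open>t \<noteq> 0\<close> the second flag
  member has sign -1, so only \<open>i = t\<close>, the one nonzero vector of level 1, can attain
  it; for \<open>t = 0\<close> all signs are 1.\<close>

lemma card_deg_top: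
  assumes g: "\<forall>b<n. g b \<in> {1, -1}" and n: "4 \<le> n" and t: "t < 2 ^ n"
  shows "card {i. i < 2 ^ n \<and> i \<noteq> 0 \<and> nbr_count g n t i s = dsum n (\<lambda>b. True)} =
    (if s then if t = 0 then 2 ^ n - 1 else 1 else 0)"
proof -
  have iff: "nbr_count g n t i s = dsum n (\<lambda>b. True) \<longleftrightarrow> s \<and> (t = 0 \<or> i = t)" if i: "i < 2 ^ n" "i \<noteq> 0" for i
  proof
    assume "nbr_count g n t i s = dsum n (\<lambda>b. True)"
    then have "dsum n (\<lambda>b. level_sign n t (min (level n t i) b) = s) = dsum n (\<lambda>b. True)"
      using nbr_count_formula[OF g t i] by simp
    from dsum_inj[OF this] have *: "level_sign n t (min (level n t i) b) = s" if "1 \<le> b" "b < n" for b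
      using that by blast
    have pos: "1 \<le> level n t i" using level_pos[OF t i(1)] i(2) by simp
    have s using *[of 1] pos level_sign_1(1)[of n t] n by (simp add: min_def split: if_splits)
    moreover have "i = t" if "t \<noteq> 0"
    proof (rule ccontr)
      assume "i \<noteq> t"
      then have "2 \<le> level n t i" using level_1[OF t i(1) that] pos i(2) by linarith
      then show False using *[of 2] level_sign_2[OF t that] \<open>s\<close> n by (simp add: min_def split: if_splits)
    qed
    ultimately show "s \<and> (t = 0 \<or> i = t)" by blast
  next
    assume R: "s \<and> (t = 0 \<or> i = t)"
    have "level_sign n t (min (level n t i) b)" if "1 \<le> b" for b
    proof (cases "t = 0")
      case True
      then show ?thesis using level_sign_0 by simp
    next
      case False
      then show ?thesis using R level_1[OF t i(1)] that level_sign_1 by (simp add: min_def)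
    qed
    then show "nbr_count g n t i s = dsum n (\<lambda>b. True)"
      unfolding nbr_count_formula[OF g t i] using R by (intro dsum_cong) auto
  qed
  have "{i. i < 2 ^ n \<and> i \<noteq> 0 \<and> nbr_count g n t i s = dsum n (\<lambda>b. True)} =
    (if s then if t = 0 then {..<2 ^ n} - {0} else {t} else {})"
    using iff t by (auto split: if_splits)
  then show ?thesis by simp
qed

text \<open>If \<open>g n = 1\<close>, the index \<open>t = 0\<close> alone supplies
  \<open>2 ^ n - 1\<close>. If \<open>g n = -1\<close>, it supplies nothing, every other
  \<open>t\<close> at most one, and at least one of these fails: by multiplicativity the norm form
  is 1 at one of the indices 1, 2, 3.\<close>

lemma sum_deg_top:
  assumes g: "\<forall>b<Suc n. g b \<in> {1, -1}" and n: "4 \<le> n"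
  shows "2 ^ n - 1 \<le> (\<Sum>t<2 ^ n. card {i. i < 2 ^ n \<and> i \<noteq> 0 \<and> nbr_count g n t i (square_pos g n t) = dsum n (\<lambda>b. True)})
    \<longleftrightarrow> g n = 1" (is "_ \<le> ?S \<longleftrightarrow> _")
proof -
  have g': "\<forall>b<n. g b \<in> {1, -1}" using g by auto
  have pow: "(16::nat) \<le> 2 ^ n" using power_increasing[OF n, of "2::nat"] by simp
  have S: "?S = (\<Sum>t<2 ^ n. if square_pos g n t then if t = 0 then 2 ^ n - 1 else 1 else 0)"
    using card_deg_top[OF g' n] by (intro sum.cong) auto
  show ?thesis
  proof
    assume "g n = 1"
    then have "square_pos g n 0" by (simp add: square_pos_chi diag_sign_0)
    then have "2 ^ n - 1 = (\<Sum>t \<in> {0}. if square_pos g n t then if t = 0 then 2 ^ n - 1 else 1 else (0::nat))" by simp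
    also have "\<dots> \<le> ?S" unfolding S by (rule sum_mono2) auto
    finally show "2 ^ n - 1 \<le> ?S" .
  next
    assume le: "2 ^ n - 1 \<le> ?S"
    show "g n = 1"
    proof (rule ccontr)
      assume "g n \<noteq> 1"
      then have gn: "g n = -1" using g by auto
      have "\<exists>t \<in> {1, 2, 3}. diag_sign g n t = 1"
        using diag_sign_small(1-3)[of n g] diag_sign_sq[OF g', of 1] diag_sign_sq[OF g', of 2] pow n by auto
      then obtain t where t: "t \<in> {1, 2, 3}" "diag_sign g n t = 1" by blast
      have nq: "\<not> square_pos g n 0" "\<not> square_pos g n t" using gn t by (simp_all add: square_pos_chi diag_sign_0)
      have "?S \<le> (\<Sum>u<2 ^ n. if u \<in> {0, t} then 0 else 1)"
        unfolding S using nq by (intro sum_mono) auto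
      also have "\<dots> = card ({..<2 ^ n} - {0, t})"
        unfolding card_eq_sum by (rule sum.mono_neutral_cong_right) auto
      also have "\<dots> = 2 ^ n - 2"
        using t pow by (subst card_Diff_subset) auto
      finally show False using le pow by simp
    qed
  qed
qed

theorem params_determined:
  assumes n: "4 \<le> n" and g: "\<forall>b<Suc n. g b \<in> {1, -1}" and h: "\<forall>b<Suc n. h b \<in> {1, -1}"
    and iso: "graph_iso (gamma_e g (Suc n)) (gamma_e h (Suc n))"
  shows "definite g \<longleftrightarrow> definite h" and "\<And>b. 3 \<le> b \<Longrightarrow> b \<le> n \<Longrightarrow> g b = h b"
proof -
  have g': "\<forall>b<n. g b \<in> {1, -1}" and h': "\<forall>b<n. h b \<in> {1, -1}" using g h by auto
  have count: "(\<Sum>t<2 ^ n. card {i. i < 2 ^ n \<and> i \<noteq> 0 \<and> nbr_count g n t i (square_pos g n t) = d}) =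
    (\<Sum>t<2 ^ n. card {i. i < 2 ^ n \<and> i \<noteq> 0 \<and> nbr_count h n t i (square_pos h n t) = d})" if "0 < d" for d
    using graph_iso_card_deg[OF iso, of d] unfolding count_deg[OF g that] count_deg[OF h that] by simp
  have pos: "0 < dsum n \<beta>" if "\<beta> 1" for \<beta>
    using dsum_Suc[of "n - 1" \<beta>] that n by simp
  \<comment> \<open>This comes before the pattern counts because they yield
    \<open>diag_sign g n (8 * y)\<close> only multiplied by \<open>g n\<close>.\<close>
  have gn: "g n = h n"
  proof -
    have "g n = 1 \<longleftrightarrow> h n = 1"
      using sum_deg_top[OF g n] sum_deg_top[OF h n] count[OF pos, of "\<lambda>b. True"] by simp
    then show ?thesis using g[rule_format, of n] h[rule_format, of n] by auto
  qed
  have *: "definite g = definite h \<and> diag_sign g n (8 * y) = diag_sign h n (8 * y)" if y: "y < 2 ^ (n - 3)" "odd y" for y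
  proof -
    have y8: "8 * y < 2 ^ n" using eight_less[of n 0 y] y n by simp
    have c: "g n * diag_sign g n (8 * y) = 1 \<or> g n * diag_sign g n (8 * y) = -1"
      "h n * diag_sign h n (8 * y) = 1 \<or> h n * diag_sign h n (8 * y) = -1"
      using diag_sign_sq[OF g' y8] diag_sign_sq[OF h' y8] g h by auto
    have "card {x \<in> {1..7}. (g n * diag_sign g n (8 * y)) * diag_sign g n x = 1} =
      card {x \<in> {1..7}. (h n * diag_sign h n (8 * y)) * diag_sign h n x = 1}"
      using count[OF pos[of "level_sign n (8 * y + 1)"]] level_sign_1(1)
      unfolding sum_deg_pattern[OF g n y] sum_deg_pattern[OF h n y] by simp
    then have "definite g = definite h \<and> g n * diag_sign g n (8 * y) = h n * diag_sign h n (8 * y)"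
      using c card_diag_sign_low[OF _ g' c(1)] card_diag_sign_low[OF _ h' c(2)] n by (auto split: if_splits)
    then show ?thesis using gn g by auto
  qed
  have two: "1 < (2::nat) ^ (n - 3)" using n by (intro one_less_power) auto
  show "definite g \<longleftrightarrow> definite h" using *[of 1] two by simp
  have 8: "diag_sign g n 8 = diag_sign h n 8" using *[of 1] two by simp
  fix b assume b: "3 \<le> b" "b \<le> n"
  consider "b = n" | "b = 3" | "4 \<le> b" "b < n" using b n by linarith
  then show "g b = h b"
  proof cases
    case 1
    then show ?thesis using gn by simp
  next
    case 2
    then show ?thesis using 8 diag_sign_pow[of 3 n g] diag_sign_pow[of 3 n h] n by simp
  next
    case 3
    \<comment> \<open>The index \<open>2 ^ b\<close> alone would give an even \<open>y\<close>.
      Adding 8 makes it odd, and the factor at 8 is already known; the factor 1 fits the shape of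
      \<open>diag_sign_add\<close>.\<close>
    define y where "y = (2::nat) ^ (b - 3) * 1 + 1"
    have e: "2 ^ b * 1 + 8 = 8 * y" using eight_pow[OF b(1)] by (simp add: y_def)
    have "1 < (2::nat) ^ (b - 3)" using 3 by (intro one_less_power) auto
    moreover have "2 ^ Suc (b - 3) \<le> (2::nat) ^ (n - 3)" using 3 by (intro power_increasing) auto
    ultimately have y: "y < 2 ^ (n - 3)" by (simp add: y_def)
    have "odd y" using 3 by (simp add: y_def)
    have b8: "(8::nat) < 2 ^ b" using power_strict_increasing[of 3 b "2::nat"] 3 by simp
    have lt: "2 ^ b * 1 + 8 < (2::nat) ^ n" unfolding e using eight_less[of n 0 y] y n by simp
    have c: "diag_sign f n (8 * y) = diag_sign f n (2 ^ b) * diag_sign f n 8" for f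
      using diag_sign_add[of b n 1 8 f] lt b8 3 unfolding e by simp
    have "diag_sign g n 8 = 1 \<or> diag_sign g n 8 = -1" using diag_sign_sq[OF g'] eight_less[of n 0 1] two n by simp
    then have "diag_sign g n (2 ^ b) = diag_sign h n (2 ^ b)"
      using *[OF y \<open>odd y\<close>] 8 unfolding c by auto
    then show ?thesis using diag_sign_pow 3 by simp
  qed
qed

section \<open>Isomorphisms of algebras and graphs\<close>

lemma graph_iso_refl: "graph_iso G G"
  unfolding graph_iso_def by (rule exI[of _ id]) auto

lemma graph_iso_sym:
  assumes "graph_iso G H"
  shows "graph_iso H G"
proof -
  obtain f where f: "bij_betw f (fst G) (fst H)"
    "\<And>x y. x \<in> fst G \<Longrightarrow> y \<in> fst G \<Longrightarrow> {x, y} \<in> snd G \<longleftrightarrow> {f x, f y} \<in> snd H"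
    using assms unfolding graph_iso_def by blast
  let ?g = "the_inv_into (fst G) f"
  have "?g x \<in> fst G" "f (?g x) = x" if "x \<in> fst H" for x
    using f(1) that the_inv_into_into[of f "fst G" x] f_the_inv_into_f[of f "fst G" x]
    unfolding bij_betw_def by auto
  then show ?thesis unfolding graph_iso_def
    using bij_betw_the_inv_into[OF f(1)] f(2) by (intro exI[of _ ?g]) simp
qed

lemma graph_iso_trans:
  assumes "graph_iso G H" "graph_iso H K"
  shows "graph_iso G K"
proof -
  obtain f where f: "bij_betw f (fst G) (fst H)"
    "\<And>x y. x \<in> fst G \<Longrightarrow> y \<in> fst G \<Longrightarrow> {x, y} \<in> snd G \<longleftrightarrow> {f x, f y} \<in> snd H"
    using assms(1) unfolding graph_iso_def by blast
  obtain f' where f': "bij_betw f' (fst H) (fst K)"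
    "\<And>x y. x \<in> fst H \<Longrightarrow> y \<in> fst H \<Longrightarrow> {x, y} \<in> snd H \<longleftrightarrow> {f' x, f' y} \<in> snd K"
    using assms(2) unfolding graph_iso_def by blast
  have "f x \<in> fst H" if "x \<in> fst G" for x using f(1) that by (rule bij_betwE[rule_format])
  then show ?thesis unfolding graph_iso_def
    using bij_betw_trans[OF f(1) f'(1)] f(2) f'(2) by (intro exI[of _ "f' \<circ> f"]) simp
qed

text \<open>Compatibility with conjugation is what lets the map pass to the next doubling. The last
  clause keeps the form of the vertices; its condition on 0 keeps their first component away from
  the unit.\<close>

definition cd_iso :: "(nat \<Rightarrow> real) \<Rightarrow> (nat \<Rightarrow> real) \<Rightarrow> nat \<Rightarrow> (cd \<Rightarrow> cd) \<Rightarrow> bool" where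
  "cd_iso g h m F \<longleftrightarrow> bij_betw F (cd_carrier m) (cd_carrier m) \<and>
    (\<forall>x \<in> cd_carrier m. cd_conj (F x) = F (cd_conj x)) \<and>
    (\<forall>x \<in> cd_carrier m. \<forall>r. F (cd_scale r x) = cd_scale r (F x)) \<and>
    (\<forall>x \<in> cd_carrier m. \<forall>y \<in> cd_carrier m. F (cd_add x y) = cd_add (F x) (F y)) \<and>
    (\<forall>x \<in> cd_carrier m. \<forall>y \<in> cd_carrier m. F (cd_mul g m x y) = cd_mul h m (F x) (F y)) \<and>
    (\<forall>j<2 ^ m. \<exists>k<2 ^ m. \<exists>s. (j = 0 \<longleftrightarrow> k = 0) \<and> F (cd_e m j) = cd_scale (sgn_of s) (cd_e m k))"

lemma cd_isoD:
  assumes "cd_iso g h m F"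
  shows "bij_betw F (cd_carrier m) (cd_carrier m)"
    and "\<And>x. x \<in> cd_carrier m \<Longrightarrow> F x \<in> cd_carrier m"
    and "\<And>x. x \<in> cd_carrier m \<Longrightarrow> F (cd_conj x) = cd_conj (F x)"
    and "\<And>x r. x \<in> cd_carrier m \<Longrightarrow> F (cd_scale r x) = cd_scale r (F x)"
    and "\<And>x y. x \<in> cd_carrier m \<Longrightarrow> y \<in> cd_carrier m \<Longrightarrow> F (cd_add x y) = cd_add (F x) (F y)"
    and "\<And>x y. x \<in> cd_carrier m \<Longrightarrow> y \<in> cd_carrier m \<Longrightarrow> F (cd_mul g m x y) = cd_mul h m (F x) (F y)"
    and "\<And>j. j < 2 ^ m \<Longrightarrow> \<exists>k<2 ^ m. \<exists>s. (j = 0 \<longleftrightarrow> k = 0) \<and> F (cd_e m j) = cd_scale (sgn_of s) (cd_e m k)"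
    and "F (cd_zero m) = cd_zero m"
    and "\<And>x y. x \<in> cd_carrier m \<Longrightarrow> y \<in> cd_carrier m \<Longrightarrow> F x = F y \<longleftrightarrow> x = y"
    and "\<And>y. y \<in> cd_carrier m \<Longrightarrow> \<exists>x \<in> cd_carrier m. y = F x"
proof -
  show bij: "bij_betw F (cd_carrier m) (cd_carrier m)" using assms by (simp add: cd_iso_def)
  show F: "\<And>x. x \<in> cd_carrier m \<Longrightarrow> F x \<in> cd_carrier m" using bij by (rule bij_betwE[rule_format])
  show "\<And>x y. x \<in> cd_carrier m \<Longrightarrow> y \<in> cd_carrier m \<Longrightarrow> F x = F y \<longleftrightarrow> x = y"
    using bij unfolding bij_betw_def inj_on_def by blast
  show "\<And>y. y \<in> cd_carrier m \<Longrightarrow> \<exists>x \<in> cd_carrier m. y = F x"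
    using bij unfolding bij_betw_def by blast
  show sc: "\<And>x r. x \<in> cd_carrier m \<Longrightarrow> F (cd_scale r x) = cd_scale r (F x)"
    using assms by (simp add: cd_iso_def)
  show "F (cd_zero m) = cd_zero m"
    using sc[OF carrier_zero, of 0] scale_0[OF carrier_zero] scale_0[OF F[OF carrier_zero]] by simp
qed (use assms in \<open>simp_all add: cd_iso_def\<close>)

fun double :: "(cd \<Rightarrow> cd) \<Rightarrow> cd \<Rightarrow> cd" where
  "double F (Pr a b) = Pr (F a) (F b)"
| "double F (Sc r) = Sc r"

lemma cd_iso_double:
  assumes iso: "cd_iso g h m F" and gh: "g m = h m"
  shows "cd_iso g h (Suc m) (double F)"
proof -
  note D = cd_isoD[OF iso]
  have bij: "bij_betw (double F) (cd_carrier (Suc m)) (cd_carrier (Suc m))"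
    unfolding bij_betw_def
  proof
    show "inj_on (double F) (cd_carrier (Suc m))"
      by (rule inj_onI) (auto simp: D(9))
    show "double F ` cd_carrier (Suc m) = cd_carrier (Suc m)"
    proof (intro equalityI subsetI)
      fix y assume "y \<in> cd_carrier (Suc m)"
      then obtain a b where "y = Pr a b" "a \<in> cd_carrier m" "b \<in> cd_carrier m" by auto
      moreover obtain a' b' where "a = F a'" "a' \<in> cd_carrier m" "b = F b'" "b' \<in> cd_carrier m"
        using D(10) calculation by metis
      ultimately show "y \<in> double F ` cd_carrier (Suc m)"
        by (intro image_eqI[of _ _ "Pr a' b'"]) auto
    qed (auto simp: D(2))
  qed
  have basis: "\<exists>k<2 ^ Suc m. \<exists>s. (j = 0 \<longleftrightarrow> k = 0) \<and> double F (cd_e (Suc m) j) = cd_scale (sgn_of s) (cd_e (Suc m) k)"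
    if "j < 2 ^ Suc m" for j
    using that
  proof (cases rule: less_Suc_pow_cases)
    case low
    then obtain k s where "k < 2 ^ m" "j = 0 \<longleftrightarrow> k = 0" "F (cd_e m j) = cd_scale (sgn_of s) (cd_e m k)"
      using D(7) by blast
    then show ?thesis using low D(8) by (intro exI[of _ k] conjI exI[of _ s]) auto
  next
    case (high j')
    then obtain k s where "k < 2 ^ m" "F (cd_e m j') = cd_scale (sgn_of s) (cd_e m k)"
      using D(7) by blast
    then show ?thesis using high D(8) by (intro exI[of _ "2 ^ m + k"] conjI exI[of _ s]) auto
  qed
  show ?thesis
    unfolding cd_iso_def
    using bij basis by (auto simp: D carrier_closed gh cd_neg_def)
qed

lemma cd_iso_line:
  assumes iso: "cd_iso g h m F" and x: "x \<in> cd_carrier m"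
  shows "F ` cd_line x = cd_line (F x)"
  unfolding cd_line_def image_image using cd_isoD(4)[OF iso x] by simp

lemma cd_iso_zero_iff:
  assumes "cd_iso g h m F" "x \<in> cd_carrier m"
  shows "F x = cd_zero m \<longleftrightarrow> x = cd_zero m"
  using cd_isoD(8)[OF assms(1)] cd_isoD(9)[OF assms carrier_zero] by simp

lemma cd_iso_mul_zero:
  assumes "cd_iso g h m F" "x \<in> cd_carrier m" "y \<in> cd_carrier m"
  shows "cd_mul h m (F x) (F y) = cd_zero m \<longleftrightarrow> cd_mul g m x y = cd_zero m"
  using cd_isoD(6)[OF assms] cd_iso_zero_iff[OF assms(1) carrier_mul[OF assms(2,3), of g]] by simp

lemma cd_iso_zero_divisor:
  assumes iso: "cd_iso g h m F" and x: "x \<in> cd_carrier m"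
  shows "cd_zero_divisor h m (F x) \<longleftrightarrow> cd_zero_divisor g m x"
proof
  assume "cd_zero_divisor h m (F x)"
  then obtain z where z: "F x \<noteq> cd_zero m" "z \<in> cd_carrier m" "z \<noteq> cd_zero m"
    "cd_mul h m (F x) z = cd_zero m \<or> cd_mul h m z (F x) = cd_zero m"
    unfolding cd_zero_divisor_def by blast
  obtain y where y: "y \<in> cd_carrier m" "z = F y" using cd_isoD(10)[OF iso z(2)] by blast
  then show "cd_zero_divisor g m x"
    using x z cd_iso_zero_iff[OF iso] cd_iso_mul_zero[OF iso x y(1)] cd_iso_mul_zero[OF iso y(1) x]
    unfolding cd_zero_divisor_def y(2) by blast
next
  assume "cd_zero_divisor g m x"
  then obtain y where y: "x \<noteq> cd_zero m" "y \<in> cd_carrier m" "y \<noteq> cd_zero m"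
    "cd_mul g m x y = cd_zero m \<or> cd_mul g m y x = cd_zero m"
    unfolding cd_zero_divisor_def by blast
  then show "cd_zero_divisor h m (F x)"
    using cd_isoD(2)[OF iso] x cd_iso_zero_iff[OF iso] cd_iso_mul_zero[OF iso x y(2)] cd_iso_mul_zero[OF iso y(2) x]
    unfolding cd_zero_divisor_def by blast
qed

lemma zero_divisor_scale:
  assumes "cd_zero_divisor g m x" "r \<noteq> 0"
  shows "cd_zero_divisor g m (cd_scale r x)"
proof -
  obtain y where y: "x \<in> cd_carrier m" "x \<noteq> cd_zero m" "y \<in> cd_carrier m" "y \<noteq> cd_zero m"
    "cd_mul g m x y = cd_zero m \<or> cd_mul g m y x = cd_zero m"
    using assms(1) unfolding cd_zero_divisor_def by blast
  have "cd_scale r x \<noteq> cd_zero m"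
  proof
    assume "cd_scale r x = cd_zero m"
    then have "cd_scale (1 / r) (cd_scale r x) = cd_zero m" by (simp del: scale_scale)
    then show False using y(2) assms(2) by simp
  qed
  then show ?thesis
    unfolding cd_zero_divisor_def using y carrier_scale[OF y(1)]
    by (auto simp: mul_scale_left mul_scale_right intro!: bexI[of _ y])
qed

lemma cd_iso_basis_surj:
  assumes iso: "cd_iso g h m F" and k: "k < 2 ^ m"
  shows "\<exists>j<2 ^ m. \<exists>s. (j = 0 \<longleftrightarrow> k = 0) \<and> cd_e m k = cd_scale (sgn_of s) (F (cd_e m j))"
proof -
  note D = cd_isoD[OF iso]
  obtain p s where p: "\<And>j. j < 2 ^ m \<Longrightarrow> p j < 2 ^ m" "\<And>j. j < 2 ^ m \<Longrightarrow> (j = 0 \<longleftrightarrow> p j = 0)"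
    "\<And>j. j < 2 ^ m \<Longrightarrow> F (cd_e m j) = cd_scale (sgn_of (s j)) (cd_e m (p j))"
    using D(7) by metis
  have p': "cd_e m (p j) = F (cd_scale (sgn_of (s j)) (cd_e m j))" if "j < 2 ^ m" for j
    using p(3)[OF that] D(4)[OF carrier_e] by simp
  have "inj_on p {..<2 ^ m}"
  proof (rule inj_onI)
    fix i j assume ij: "i \<in> {..<2 ^ m}" "j \<in> {..<2 ^ m}" "p i = p j"
    then have "F (cd_scale (sgn_of (s i)) (cd_e m i)) = F (cd_scale (sgn_of (s j)) (cd_e m j))"
      using p'[of i] p'[of j] by simp
    then have "cd_scale (sgn_of (s i)) (cd_e m i) = cd_scale (sgn_of (s j)) (cd_e m j)"
      using D(9)[OF carrier_scale[OF carrier_e] carrier_scale[OF carrier_e]] by blast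
    then show "i = j" using scale_e_eq[of i m j "sgn_of (s i)" "sgn_of (s j)"] ij by simp
  qed
  then have "p ` {..<2 ^ m} = {..<2 ^ m}"
    using p(1) by (intro endo_inj_surj) auto
  then obtain j where j: "j < 2 ^ m" "k = p j" using k by (metis imageE lessThan_iff)
  have "cd_e m (p j) = cd_scale (sgn_of (s j)) (F (cd_e m j))"
    using p(3)[OF j(1)] by simp
  then show ?thesis using p(2)[OF j(1)] j by metis
qed

lemma line_scale:
  assumes "r \<noteq> 0"
  shows "cd_line (cd_scale r x) = cd_line x"
proof (intro equalityI subsetI)
  fix y assume "y \<in> cd_line (cd_scale r x)"
  then show "y \<in> cd_line x" unfolding cd_line_def by auto
next
  fix y assume "y \<in> cd_line x"
  then obtain s where "y = cd_scale s x" unfolding cd_line_def by auto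
  then have "y = cd_scale (s / r) (cd_scale r x)" using assms by simp
  then show "y \<in> cd_line (cd_scale r x)" unfolding cd_line_def by blast
qed

lemma sgn_of_mult: "\<exists>s. sgn_of s = sgn_of a * sgn_of b"
  by (rule exI[of _ "a = b"]) (auto simp: sgn_of_def)

lemma double_vtx:
  assumes iso: "cd_iso g h n F" and ij: "i < 2 ^ n" "j < 2 ^ n"
  shows "\<exists>k<2 ^ n. \<exists>l<2 ^ n. \<exists>s' a. (i = 0 \<longleftrightarrow> k = 0) \<and> double F (vtx n i j s) = cd_scale (sgn_of a) (vtx n k l s')"
proof -
  note D = cd_isoD[OF iso]
  obtain k a where k: "k < 2 ^ n" "i = 0 \<longleftrightarrow> k = 0" "F (cd_e n i) = cd_scale (sgn_of a) (cd_e n k)"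
    using D(7)[OF ij(1)] by blast
  obtain l b where l: "l < 2 ^ n" "F (cd_e n j) = cd_scale (sgn_of b) (cd_e n l)"
    using D(7)[OF ij(2)] by blast
  obtain c where c: "sgn_of c = sgn_of s * sgn_of b" using sgn_of_mult by metis
  obtain s' where s': "sgn_of s' = sgn_of a * sgn_of c" using sgn_of_mult by metis
  have "double F (vtx n i j s) = cd_scale (sgn_of a) (vtx n k l s')"
    by (simp add: vtx_def k l D(4) carrier_e s' c mult_ac)
  then show ?thesis using k(1,2) l(1) by metis
qed

lemma double_vtx_surj:
  assumes iso: "cd_iso g h n F" and kl: "k < 2 ^ n" "l < 2 ^ n"
  shows "\<exists>i<2 ^ n. \<exists>j<2 ^ n. \<exists>s' a. (i = 0 \<longleftrightarrow> k = 0) \<and> vtx n k l s = cd_scale (sgn_of a) (double F (vtx n i j s'))"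
proof -
  note D = cd_isoD[OF iso]
  obtain i a where i: "i < 2 ^ n" "i = 0 \<longleftrightarrow> k = 0" "cd_e n k = cd_scale (sgn_of a) (F (cd_e n i))"
    using cd_iso_basis_surj[OF iso kl(1)] by blast
  obtain j b where j: "j < 2 ^ n" "cd_e n l = cd_scale (sgn_of b) (F (cd_e n j))"
    using cd_iso_basis_surj[OF iso kl(2)] by blast
  obtain c where c: "sgn_of c = sgn_of s * sgn_of b" using sgn_of_mult by metis
  obtain s' where s': "sgn_of s' = sgn_of a * sgn_of c" using sgn_of_mult by metis
  have "vtx n k l s = cd_scale (sgn_of a) (double F (vtx n i j s'))"
    by (simp add: vtx_def i(3) j(2) D(4) carrier_e s' c mult_ac)
  then show ?thesis using i(1,2) j(1) by metis
qed

text \<open>The isomorphism is taken one level below and doubled: acting on both components alike,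
  it preserves the shape \<open>(e_i, \<plusminus> e_j)\<close> up to a common sign, and lines are
  mapped to their images.\<close>

lemma graph_iso_of_cd_iso:
  assumes iso: "cd_iso g h n F" and gh: "g n = h n"
    and g: "\<forall>b<Suc n. g b \<in> {1, -1}" and h: "\<forall>b<Suc n. h b \<in> {1, -1}"
  shows "graph_iso (gamma_e g (Suc n)) (gamma_e h (Suc n))"
proof -
  define L where "L = double F"
  have isoL: "cd_iso g h (Suc n) L" unfolding L_def by (rule cd_iso_double[OF iso gh])
  note DL = cd_isoD[OF isoL]
  have lineL: "L ` cd_line (vtx n i j s) = cd_line (L (vtx n i j s))" for i j s
    by (rule cd_iso_line[OF isoL vtx_carrier])
  have orth: "cd_orth h (Suc n) (L u) (L v) \<longleftrightarrow> cd_orth g (Suc n) u v"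
    if "u \<in> cd_carrier (Suc n)" "v \<in> cd_carrier (Suc n)" for u v
    unfolding cd_orth_def using cd_iso_mul_zero[OF isoL] that by simp
  have vertD: "\<exists>u. x = cd_line u \<and> u \<in> cd_carrier (Suc n)" if "x \<in> fst (gamma_e g (Suc n))" for x
    using that vtx_carrier unfolding verts_eq[OF g] by blast
  have image: "(`) L ` fst (gamma_e g (Suc n)) = fst (gamma_e h (Suc n))"
  proof (intro equalityI subsetI)
    fix y assume "y \<in> (`) L ` fst (gamma_e g (Suc n))"
    then obtain i j s where i: "i < 2 ^ n" "i \<noteq> 0" "j < 2 ^ n" "cd_zero_divisor g (Suc n) (vtx n i j s)"
      "y = cd_line (L (vtx n i j s))"
      unfolding verts_eq[OF g] using lineL by auto
    obtain k l s' a where k: "k < 2 ^ n" "l < 2 ^ n" "i = 0 \<longleftrightarrow> k = 0" "L (vtx n i j s) = cd_scale (sgn_of a) (vtx n k l s')"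
      using double_vtx[OF iso i(1,3), of s] unfolding L_def by blast
    have "cd_zero_divisor h (Suc n) (L (vtx n i j s))"
      using cd_iso_zero_divisor[OF isoL vtx_carrier] i(4) by simp
    then have "cd_zero_divisor h (Suc n) (cd_scale (sgn_of a) (cd_scale (sgn_of a) (vtx n k l s')))"
      unfolding k(4) by (rule zero_divisor_scale) simp
    moreover have "y = cd_line (vtx n k l s')" unfolding i(5) k(4) by (rule line_scale) simp
    ultimately show "y \<in> fst (gamma_e h (Suc n))" unfolding verts_eq[OF h] using k i(2) by auto
  next
    fix y assume "y \<in> fst (gamma_e h (Suc n))"
    then obtain k l s where k: "k < 2 ^ n" "k \<noteq> 0" "l < 2 ^ n" "cd_zero_divisor h (Suc n) (vtx n k l s)"
      "y = cd_line (vtx n k l s)"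
      unfolding verts_eq[OF h] by auto
    obtain i j s' a where i: "i < 2 ^ n" "j < 2 ^ n" "i = 0 \<longleftrightarrow> k = 0" "vtx n k l s = cd_scale (sgn_of a) (L (vtx n i j s'))"
      using double_vtx_surj[OF iso k(1,3), of s] unfolding L_def by blast
    have "cd_zero_divisor h (Suc n) (cd_scale (sgn_of a) (vtx n k l s))"
      using k(4) by (rule zero_divisor_scale) simp
    then have "cd_zero_divisor g (Suc n) (vtx n i j s')"
      unfolding i(4) using cd_iso_zero_divisor[OF isoL vtx_carrier] by simp
    moreover have "y = L ` cd_line (vtx n i j s')" unfolding k(5) i(4) lineL by (rule line_scale) simp
    ultimately show "y \<in> (`) L ` fst (gamma_e g (Suc n))" unfolding verts_eq[OF g] using i k(2) by blast
  qed
  have "inj_on ((`) L) (fst (gamma_e g (Suc n)))"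
  proof (rule inj_onI)
    fix x y assume xy: "x \<in> fst (gamma_e g (Suc n))" "y \<in> fst (gamma_e g (Suc n))" "L ` x = L ` y"
    have "x \<subseteq> cd_carrier (Suc n)" "y \<subseteq> cd_carrier (Suc n)"
      using vertD[OF xy(1)] vertD[OF xy(2)] carrier_scale unfolding cd_line_def by blast+
    then show "x = y" using xy(3) DL(1) inj_on_image_eq_iff[of L "cd_carrier (Suc n)"]
      unfolding bij_betw_def by blast
  qed
  then have bij: "bij_betw ((`) L) (fst (gamma_e g (Suc n))) (fst (gamma_e h (Suc n)))"
    using image by (simp add: bij_betw_def)
  have "{x, y} \<in> snd (gamma_e g (Suc n)) \<longleftrightarrow> {L ` x, L ` y} \<in> snd (gamma_e h (Suc n))"
    if xy: "x \<in> fst (gamma_e g (Suc n))" "y \<in> fst (gamma_e g (Suc n))" for x y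
  proof -
    obtain u where u: "x = cd_line u" "u \<in> cd_carrier (Suc n)" using vertD[OF xy(1)] by blast
    obtain v where v: "y = cd_line v" "v \<in> cd_carrier (Suc n)" using vertD[OF xy(2)] by blast
    have 1: "(\<exists>u' v'. x = cd_line u' \<and> y = cd_line v' \<and> cd_orth g (Suc n) u' v') \<longleftrightarrow> cd_orth g (Suc n) u v"
      unfolding u(1) v(1) by (rule orth_line[OF u(2) v(2)])
    have 2: "(\<exists>u' v'. L ` x = cd_line u' \<and> L ` y = cd_line v' \<and> cd_orth h (Suc n) u' v') \<longleftrightarrow> cd_orth h (Suc n) (L u) (L v)"
      unfolding u(1) v(1) cd_iso_line[OF isoL u(2)] cd_iso_line[OF isoL v(2)]
      by (rule orth_line[OF DL(2)[OF u(2)] DL(2)[OF v(2)]])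
    have "L ` x \<in> fst (gamma_e h (Suc n))" "L ` y \<in> fst (gamma_e h (Suc n))" "L ` x = L ` y \<longleftrightarrow> x = y"
      using bij xy unfolding bij_betw_def inj_on_def by blast+
    then show ?thesis
      unfolding edges_iff[OF g] edges_iff[OF h] 1 2 orth[OF u(2) v(2)] using xy by blast
  qed
  then show ?thesis using bij unfolding graph_iso_def by blast
qed

lemma cd_iso_iterate:
  assumes "cd_iso g h m F" "m \<le> n" "\<forall>b. m \<le> b \<and> b < n \<longrightarrow> g b = h b"
  shows "\<exists>F. cd_iso g h n F"
  using assms(2,3)
proof (induction n rule: dec_induct)
  case base
  then show ?case using assms(1) by blast
next
  case (step n)
  then obtain F where "cd_iso g h n F" by auto
  moreover have "g n = h n" using step by simp
  ultimately show ?case using cd_iso_double by blast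
qed

lemma graph_iso_params:
  assumes "cd_iso g h m F" "m \<le> n" "\<forall>b. m \<le> b \<and> b < Suc n \<longrightarrow> g b = h b"
    and "\<forall>b<Suc n. g b \<in> {1, -1}" and "\<forall>b<Suc n. h b \<in> {1, -1}"
  shows "graph_iso (gamma_e g (Suc n)) (gamma_e h (Suc n))"
proof -
  obtain F' where "cd_iso g h n F'" using cd_iso_iterate[OF assms(1,2)] assms(3) by auto
  then show ?thesis using graph_iso_of_cd_iso assms(2-5) by blast
qed

text \<open>The real numbers involve no parameter, so iterated doubling from here compares sequences
  that agree at the positions in use.\<close>

lemma cd_iso_id: "cd_iso g h 0 id"
  unfolding cd_iso_def by (auto intro!: exI[of _ True] simp: sgn_of_def)

text \<open>Exchanges the generators of the last two doublings. They anticommute, so their product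
  changes sign, hence \<open>cd_neg d\<close>. The entries will be in the real numbers or in the
  algebra of depth 1, both commutative.\<close>

fun swap_gen :: "cd \<Rightarrow> cd" where
  "swap_gen (Pr (Pr a b) (Pr c d)) = Pr (Pr a c) (Pr b (cd_neg d))"
| "swap_gen x = x"

lemma cd_isoI:
  assumes "bij_betw F (cd_carrier m) (cd_carrier m)"
    and "\<forall>x \<in> cd_carrier m. cd_conj (F x) = F (cd_conj x)"
    and "\<forall>x \<in> cd_carrier m. \<forall>r. F (cd_scale r x) = cd_scale r (F x)"
    and "\<forall>x \<in> cd_carrier m. \<forall>y \<in> cd_carrier m. F (cd_add x y) = cd_add (F x) (F y)"
    and "\<forall>x \<in> cd_carrier m. \<forall>y \<in> cd_carrier m. F (cd_mul g m x y) = cd_mul h m (F x) (F y)"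
    and "\<And>j. j < 2 ^ m \<Longrightarrow> p j < 2 ^ m \<and> (j = 0 \<longleftrightarrow> p j = 0) \<and> F (cd_e m j) = cd_scale (sgn_of (s j)) (cd_e m (p j))"
  shows "cd_iso g h m F"
  unfolding cd_iso_def using assms(6) by (intro conjI assms(1-5)) blast

lemma cd_iso_swap01: "cd_iso g (g(0 := g 1, 1 := g 0)) 2 swap_gen"
proof (rule cd_isoI)
  show "bij_betw swap_gen (cd_carrier 2) (cd_carrier 2)"
    by (rule bij_betw_byWitness[of _ swap_gen]) (auto simp: numeral_2_eq_2 cd_neg_def)
  show "\<forall>x \<in> cd_carrier 2. \<forall>y \<in> cd_carrier 2.
    swap_gen (cd_mul g 2 x y) = cd_mul (g(0 := g 1, 1 := g 0)) 2 (swap_gen x) (swap_gen y)"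
    by (auto simp: numeral_2_eq_2 cd_neg_def algebra_simps)
  fix j :: nat assume "j < 2 ^ 2"
  then have "j \<in> {0, 1, 2, 3}" by auto
  then show "([0, 2, 1, 3] :: nat list) ! j < 2 ^ 2 \<and> (j = 0 \<longleftrightarrow> ([0, 2, 1, 3] :: nat list) ! j = 0) \<and>
    swap_gen (cd_e 2 j) = cd_scale (sgn_of (j < 3)) (cd_e 2 (([0, 2, 1, 3] :: nat list) ! j))"
    by (auto simp: eval_nat_numeral cd_neg_def sgn_of_def)
qed (auto simp: numeral_2_eq_2 cd_neg_def)

lemma cd_iso_swap12: "cd_iso g (g(1 := g 2, 2 := g 1)) 3 swap_gen"
proof (rule cd_isoI)
  show "bij_betw swap_gen (cd_carrier 3) (cd_carrier 3)"
    by (rule bij_betw_byWitness[of _ swap_gen]) (auto simp: numeral_3_eq_3 cd_neg_def)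
  show "\<forall>x \<in> cd_carrier 3. \<forall>y \<in> cd_carrier 3.
    swap_gen (cd_mul g 3 x y) = cd_mul (g(1 := g 2, 2 := g 1)) 3 (swap_gen x) (swap_gen y)"
    by (auto simp: eval_nat_numeral cd_neg_def algebra_simps)
  fix j :: nat assume "j < 2 ^ 3"
  then have "j \<in> {0, 1, 2, 3, 4, 5, 6, 7}" by auto
  then show "([0, 1, 4, 5, 2, 3, 6, 7] :: nat list) ! j < 2 ^ 3 \<and> (j = 0 \<longleftrightarrow> ([0, 1, 4, 5, 2, 3, 6, 7] :: nat list) ! j = 0) \<and>
    swap_gen (cd_e 3 j) = cd_scale (sgn_of (j < 6)) (cd_e 3 (([0, 1, 4, 5, 2, 3, 6, 7] :: nat list) ! j))"
    by (auto simp: eval_nat_numeral cd_neg_def sgn_of_def)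
qed (auto simp: numeral_3_eq_3 cd_neg_def)

text \<open>Replaces the generator \<open>e_2\<close> by \<open>e_3\<close>, whose square is
  \<open>- (g 0 * g 1)\<close>. The scalar \<open>r = g 0\<close> stems from
  \<open>e_1 e_3 = g 0 e_2\<close>.\<close>

fun twist_gen :: "real \<Rightarrow> cd \<Rightarrow> cd" where
  "twist_gen r (Pr p (Pr c d)) = Pr p (Pr d (cd_scale r c))"
| "twist_gen r x = x"

fun untwist_gen :: "real \<Rightarrow> cd \<Rightarrow> cd" where
  "untwist_gen r (Pr p (Pr c d)) = Pr p (Pr (cd_scale r d) c)"
| "untwist_gen r x = x"

lemma cd_iso_twist:
  assumes "g 0 = 1 \<or> g 0 = -1"
  shows "cd_iso g (g(1 := - (g 0 * g 1))) 2 (twist_gen (g 0))"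
proof (rule cd_isoI)
  have g0: "g 0 * g 0 = 1" "g 0 * (g 0 * z) = z" for z using assms by auto
  show "bij_betw (twist_gen (g 0)) (cd_carrier 2) (cd_carrier 2)"
    by (rule bij_betw_byWitness[of _ "untwist_gen (g 0)"]) (auto simp: numeral_2_eq_2 cd_neg_def g0)
  show "\<forall>x \<in> cd_carrier 2. \<forall>y \<in> cd_carrier 2.
    twist_gen (g 0) (cd_mul g 2 x y) = cd_mul (g(1 := - (g 0 * g 1))) 2 (twist_gen (g 0) x) (twist_gen (g 0) y)"
    by (auto simp: numeral_2_eq_2 cd_neg_def algebra_simps g0)
  fix j :: nat assume "j < 2 ^ 2"
  then have "j \<in> {0, 1, 2, 3}" by auto
  then show "([0, 1, 3, 2] :: nat list) ! j < 2 ^ 2 \<and> (j = 0 \<longleftrightarrow> ([0, 1, 3, 2] :: nat list) ! j = 0) \<and>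
    twist_gen (g 0) (cd_e 2 j) = cd_scale (sgn_of (j = 2 \<longrightarrow> g 0 = 1)) (cd_e 2 (([0, 1, 3, 2] :: nat list) ! j))"
    using assms by (auto simp: eval_nat_numeral cd_neg_def sgn_of_def)
qed (auto simp: numeral_2_eq_2 cd_neg_def algebra_simps)

definition set_low :: "real \<Rightarrow> real \<Rightarrow> real \<Rightarrow> (nat \<Rightarrow> real) \<Rightarrow> nat \<Rightarrow> real" where
  "set_low a b c g = g(0 := a, 1 := b, 2 := c)"

lemma set_low_simps [simp]: "set_low a b c g 0 = a" "set_low a b c g 1 = b" "set_low a b c g (Suc 0) = b" "set_low a b c g 2 = c"
  "3 \<le> k \<Longrightarrow> set_low a b c g k = g k"
  by (simp_all add: set_low_def)

lemma set_low_self: "set_low (g 0) (g 1) (g 2) g = g"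
  by (simp add: set_low_def)

text \<open>The three generating moves act transitively on the sign triples other than \<open>(-1, -1, -1)\<close>.\<close>

lemma graph_iso_split:
  assumes n: "3 \<le> n" and g: "\<forall>b<Suc n. g b \<in> {1, -1}" and nd: "\<not> definite g"
  shows "graph_iso (gamma_e g (Suc n)) (gamma_e (set_low 1 1 1 g) (Suc n))"
proof -
  define P where "P a b c \<longleftrightarrow> graph_iso (gamma_e (set_low a b c g) (Suc n)) (gamma_e (set_low 1 1 1 g) (Suc n))" for a b c
  have sgn_of: "\<forall>k<Suc n. set_low a b c g k \<in> {1, -1}" if "a \<in> {1, -1}" "b \<in> {1, -1}" "c \<in> {1, -1}" for a b c
    using that g by (auto simp: set_low_def)
  have S1: "P a b c" if "P b a c" "a \<in> {1, -1}" "b \<in> {1, -1}" "c \<in> {1, -1}" for a b c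
  proof -
    have e: "(set_low a b c g)(0 := set_low a b c g 1, 1 := set_low a b c g 0) = set_low b a c g" by (auto simp: set_low_def)
    have "graph_iso (gamma_e (set_low a b c g) (Suc n)) (gamma_e (set_low b a c g) (Suc n))"
      using cd_iso_swap01[of "set_low a b c g", unfolded e]
      by (rule graph_iso_params) (use n that sgn_of in \<open>auto simp: set_low_def\<close>)
    then show ?thesis using that(1) graph_iso_trans unfolding P_def by blast
  qed
  have S2: "P a b c" if "P a c b" "a \<in> {1, -1}" "b \<in> {1, -1}" "c \<in> {1, -1}" for a b c
  proof -
    have e: "(set_low a b c g)(1 := set_low a b c g 2, 2 := set_low a b c g 1) = set_low a c b g" by (auto simp: set_low_def)
    have "graph_iso (gamma_e (set_low a b c g) (Suc n)) (gamma_e (set_low a c b g) (Suc n))"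
      using cd_iso_swap12[of "set_low a b c g", unfolded e]
      by (rule graph_iso_params) (use n that sgn_of in \<open>auto simp: set_low_def\<close>)
    then show ?thesis using that(1) graph_iso_trans unfolding P_def by blast
  qed
  have S3: "P a b c" if "P a (- (a * b)) c" "a \<in> {1, -1}" "b \<in> {1, -1}" "c \<in> {1, -1}" for a b c
  proof -
    have e: "(set_low a b c g)(1 := - (set_low a b c g 0 * set_low a b c g 1)) = set_low a (- (a * b)) c g" by (auto simp: set_low_def)
    have "cd_iso (set_low a b c g) (set_low a (- (a * b)) c g) 2 (twist_gen (set_low a b c g 0))"
      using cd_iso_twist[of "set_low a b c g", unfolded e] that(2) by auto
    then have "graph_iso (gamma_e (set_low a b c g) (Suc n)) (gamma_e (set_low a (- (a * b)) c g) (Suc n))"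
      by (rule graph_iso_params) (use n that sgn_of[OF that(2-4)] sgn_of[of a "- (a * b)" c] in \<open>auto simp: set_low_def\<close>)
    then show ?thesis using that(1) graph_iso_trans unfolding P_def by blast
  qed
  have ppp: "P 1 1 1" unfolding P_def by (rule graph_iso_refl)
  have pnp: "P 1 (-1) 1" using S3[where a = 1 and b = "-1" and c = 1] ppp by simp
  have ppn: "P 1 1 (-1)" using S2[where a = 1 and b = 1 and c = "-1"] pnp by simp
  have pnn: "P 1 (-1) (-1)" using S3[where a = 1 and b = "-1" and c = "-1"] ppn by simp
  have npp: "P (-1) 1 1" using S1[where a = "-1" and b = 1 and c = 1] pnp by simp
  have npn: "P (-1) 1 (-1)" using S1[where a = "-1" and b = 1 and c = "-1"] pnn by simp
  have nnp: "P (-1) (-1) 1" using S2[where a = "-1" and b = "-1" and c = 1] npn by simp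
  have "g 0 = 1 \<or> g 0 = -1" "g 1 = 1 \<or> g 1 = -1" "g 2 = 1 \<or> g 2 = -1" using g n by auto
  then have "P (g 0) (g 1) (g 2)"
    using nd ppp pnp ppn pnn npp npn nnp unfolding definite_def by metis
  then show ?thesis unfolding P_def set_low_self .
qed

text \<open>In the definite case the two sequences agree at all positions in use; otherwise both are
  brought to the first three entries 1, 1, 1.\<close>

lemma graph_iso_low:
  assumes n: "3 \<le> n" and g: "\<forall>b<Suc n. g b \<in> {1, -1}" and h: "\<forall>b<Suc n. h b \<in> {1, -1}"
    and d: "definite g \<longleftrightarrow> definite h" and gh: "\<And>b. 3 \<le> b \<Longrightarrow> b \<le> n \<Longrightarrow> g b = h b"
  shows "graph_iso (gamma_e g (Suc n)) (gamma_e h (Suc n))"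
proof -
  have cong: "graph_iso (gamma_e f (Suc n)) (gamma_e f' (Suc n))"
    if "\<forall>b<Suc n. f b \<in> {1, -1}" "\<forall>b<Suc n. f b = f' b" for f f'
    using cd_iso_id by (rule graph_iso_params) (use that in auto)
  show ?thesis
  proof (cases "definite g")
    case True
    then have "g b = h b" if "b < Suc n" for b
    proof -
      consider "b = 0" | "b = 1" | "b = 2" | "3 \<le> b" by linarith
      then show ?thesis using True d gh[of b] that unfolding definite_def by cases auto
    qed
    then show ?thesis using cong g by blast
  next
    case False
    have l: "\<forall>b<Suc n. set_low 1 1 1 g b = set_low 1 1 1 h b"
      using gh by (auto simp: set_low_def)
    have "\<forall>b<Suc n. set_low 1 1 1 g b \<in> {1, -1}" using g by (auto simp: set_low_def)
    then have "graph_iso (gamma_e (set_low 1 1 1 g) (Suc n)) (gamma_e (set_low 1 1 1 h) (Suc n))"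
      using cong l by blast
    then show ?thesis
      using graph_iso_split[OF n g False] graph_iso_sym[OF graph_iso_split[OF n h]] False d
      by (blast intro: graph_iso_trans)
  qed
qed

theorem theorem5p12:
  fixes n :: nat and \<gamma> \<mu> :: "nat \<Rightarrow> real"
  assumes "n \<ge> 4"
    and "\<forall>i\<le>n. \<gamma> i \<in> {1, -1}"
    and "\<forall>i\<le>n. \<mu> i \<in> {1, -1}"
    and "graph_iso (gamma_e \<gamma> (n + 1)) (gamma_e \<mu> (n + 1))"
  shows "graph_iso (gamma_e (circ_params n \<gamma>) n) (gamma_e (circ_params n \<mu>) n) \<and>
         graph_iso (gamma_e (bullet_params n \<gamma>) n) (gamma_e (bullet_params n \<mu>) n)"
proof -
  obtain m where m: "n = Suc m" "3 \<le> m" using assms(1) by (cases n) auto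
  have g: "\<forall>b<Suc n. \<gamma> b \<in> {1, -1}" and h: "\<forall>b<Suc n. \<mu> b \<in> {1, -1}"
    using assms(2,3) by (simp_all add: less_Suc_eq_le)
  note det = params_determined[OF assms(1) g h assms(4)[unfolded Suc_eq_plus1[symmetric]]]
  have "\<gamma> n * \<gamma> m \<in> {1, -1}" "\<mu> n * \<mu> m \<in> {1, -1}" using g[rule_format, of n] g[rule_format, of m]
    h[rule_format, of n] h[rule_format, of m] m by auto
  note sgn = this
  \<comment> \<open>Only position \<open>m\<close>, at least 3, is altered: definiteness is
    unaffected, and the new entry is a parameter, or a product of two, that the graph
    determines.\<close>
  have "graph_iso (gamma_e (circ_params n \<gamma>) (Suc m)) (gamma_e (circ_params n \<mu>) (Suc m))"
    using m(2) by (rule graph_iso_low) (use g h det m in \<open>auto simp: circ_params_def definite_def\<close>)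
  moreover have "graph_iso (gamma_e (bullet_params n \<gamma>) (Suc m)) (gamma_e (bullet_params n \<mu>) (Suc m))"
    using m(2) by (rule graph_iso_low) (use g h det m sgn in \<open>auto simp: bullet_params_def definite_def mult.commute\<close>)
  ultimately show ?thesis unfolding m(1) by simp
qed

end
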